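(* There exists a finitely generated MIF group which is not sharply MIF.
   Context: For a group $\Gamma$, let $\Gamma\ast\mathbb{Z}$ be the free product of $\Gamma$ with an infinite cyclic group $\mathbb{Z}=\langle x\rangle$. For $w\in\Gamma\ast\mathbb{Z}$ and $g\in\Gamma$, let $w(g)\in\Gamma$ be the image of $w$ under the unique homomorphism $\Gamma\ast\mathbb{Z}\to\Gamma$ that is the identity on $\Gamma$ and sends $x$ to $g$. A mixed identity for $\Gamma$ is a nontrivial $w\in\Gamma\ast\mathbb{Z}$ such that $w(g)=e_\Gamma$ for all $g\in\Gamma$. The group $\Gamma$ is MIF (mixed identity-free) if it has no mixed identity. Given a finite generating set $S$ of $\Gamma$, $|\cdot|_S$ denotes word-length on $\Gamma$ with respect to $S$ and $|\cdot|_{S\cup\{x\}}$ denotes word-length on $\Gamma\ast\mathbb{Z}$ with respect to $S\cup\{x\}$. The complexity of $w$ is $\chi_\Gamma^S(w)=\min\{|g|_S : g\in\Gamma,\ w(g)\neq e_\Gamma\}$, with value $+\infty$ if there is no such $g$. The MIF growth function is $$\mathcal{M}_\Gamma^S(n)=\max\{\chi_\Gamma^S(w) : w\in\Gamma\ast\mathbb{Z},\ w\neq e,\ |w|_{S\cup\{x\}}\leq n\}.$$ A finitely generated group $\Gamma$ is sharply MIF if for some (equivalently, every) finite generating set $S$ there is a constant $C>0$ (depending on $S$) such that $\mathcal{M}_\Gamma^S(n)\leq C\log(n)$ for all $n\geq 2$. *)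

theory Defs
  imports
    "HOL-Algebra.Elementary_Groups"
    "HOL-Algebra.Generated_Groups"
    "HOL-Library.Extended_Real"
begin

section \<open>Free products\<close>

text \<open>
  The free product is the monoid of words in the elements of both factors, modulo the congruence
  that multiplies adjacent letters of the same factor and deletes identity letters.
\<close>

definition fp_words :: "('a, 'c) monoid_scheme \<Rightarrow> ('b, 'd) monoid_scheme \<Rightarrow> ('a + 'b) list set"
  where "fp_words G H = lists (carrier G <+> carrier H)"

inductive fp_eq ::
    "('a, 'c) monoid_scheme \<Rightarrow> ('b, 'd) monoid_scheme \<Rightarrow> ('a + 'b) list \<Rightarrow> ('a + 'b) list \<Rightarrow> bool"
  for G H
where
  refl: "u \<in> fp_words G H \<Longrightarrow> fp_eq G H u u"
| sym: "fp_eq G H u v \<Longrightarrow> fp_eq G H v u"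
| trans: "fp_eq G H u v \<Longrightarrow> fp_eq G H v w \<Longrightarrow> fp_eq G H u w"
| multl: "u \<in> fp_words G H \<Longrightarrow> v \<in> fp_words G H \<Longrightarrow> a \<in> carrier G \<Longrightarrow> b \<in> carrier G \<Longrightarrow>
    fp_eq G H (u @ [Inl a, Inl b] @ v) (u @ [Inl (a \<otimes>\<^bsub>G\<^esub> b)] @ v)"
| multr: "u \<in> fp_words G H \<Longrightarrow> v \<in> fp_words G H \<Longrightarrow> a \<in> carrier H \<Longrightarrow> b \<in> carrier H \<Longrightarrow>
    fp_eq G H (u @ [Inr a, Inr b] @ v) (u @ [Inr (a \<otimes>\<^bsub>H\<^esub> b)] @ v)"
| onel: "u \<in> fp_words G H \<Longrightarrow> v \<in> fp_words G H \<Longrightarrow> fp_eq G H (u @ [Inl \<one>\<^bsub>G\<^esub>] @ v) (u @ v)"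
| oner: "u \<in> fp_words G H \<Longrightarrow> v \<in> fp_words G H \<Longrightarrow> fp_eq G H (u @ [Inr \<one>\<^bsub>H\<^esub>] @ v) (u @ v)"

definition fp_rel ::
    "('a, 'c) monoid_scheme \<Rightarrow> ('b, 'd) monoid_scheme \<Rightarrow> (('a + 'b) list \<times> ('a + 'b) list) set"
  where "fp_rel G H = {(u, v). fp_eq G H u v}"

definition fp_class ::
    "('a, 'c) monoid_scheme \<Rightarrow> ('b, 'd) monoid_scheme \<Rightarrow> ('a + 'b) list \<Rightarrow> ('a + 'b) list set"
  where "fp_class G H u = fp_rel G H `` {u}"

definition free_product ::
    "('a, 'c) monoid_scheme \<Rightarrow> ('b, 'd) monoid_scheme \<Rightarrow> ('a + 'b) list set monoid"
  where "free_product G H =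
    \<lparr>carrier = fp_words G H // fp_rel G H,
     monoid.mult = (\<lambda>A B. \<Union>u\<in>A. \<Union>v\<in>B. fp_class G H (u @ v)),
     one = fp_class G H []\<rparr>"

section \<open>Mixed identities\<close>

abbreviation mixed_words :: "('a, 'c) monoid_scheme \<Rightarrow> ('a + int) list set monoid"
  where "mixed_words G \<equiv> free_product G integer_group"

definition mw_const :: "('a, 'c) monoid_scheme \<Rightarrow> 'a \<Rightarrow> ('a + int) list set"
  where "mw_const G a = fp_class G integer_group [Inl a]"

definition mw_var :: "('a, 'c) monoid_scheme \<Rightarrow> ('a + int) list set"
  where "mw_var G = fp_class G integer_group [Inr 1]"

text \<open>
  The substitution homomorphism; extensionality is needed for literal uniqueness, as functions
  in HOL are total.
\<close>

definition mw_subst :: "('a, 'c) monoid_scheme \<Rightarrow> 'a \<Rightarrow> ('a + int) list set \<Rightarrow> 'a"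
  where "mw_subst G g =
    (THE h. h \<in> hom (mixed_words G) G \<and> h \<in> extensional (carrier (mixed_words G)) \<and>
       (\<forall>a\<in>carrier G. h (mw_const G a) = a) \<and> h (mw_var G) = g)"

definition mixed_identity :: "('a, 'c) monoid_scheme \<Rightarrow> ('a + int) list set \<Rightarrow> bool"
  where "mixed_identity G w \<longleftrightarrow>
    w \<in> carrier (mixed_words G) \<and> w \<noteq> \<one>\<^bsub>mixed_words G\<^esub> \<and>
    (\<forall>g\<in>carrier G. mw_subst G g w = \<one>\<^bsub>G\<^esub>)"

definition MIF :: "('a, 'c) monoid_scheme \<Rightarrow> bool"
  where "MIF G \<longleftrightarrow> (\<nexists>w. mixed_identity G w)"

section \<open>MIF growth\<close>

definition finite_generating_set :: "('a, 'c) monoid_scheme \<Rightarrow> 'a set \<Rightarrow> bool"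
  where "finite_generating_set G S \<longleftrightarrow>
    finite S \<and> S \<subseteq> carrier G \<and> generate G S = carrier G"

definition finitely_generated :: "('a, 'c) monoid_scheme \<Rightarrow> bool"
  where "finitely_generated G \<longleftrightarrow> (\<exists>S. finite_generating_set G S)"

text \<open>Word length is infinite outside the subgroup generated by the set.\<close>

definition word_length :: "('a, 'c) monoid_scheme \<Rightarrow> 'a set \<Rightarrow> 'a \<Rightarrow> enat"
  where "word_length G S g =
    (INF ws \<in> {ws. set ws \<subseteq> S \<union> m_inv G ` S \<and> foldr (\<otimes>\<^bsub>G\<^esub>) ws \<one>\<^bsub>G\<^esub> = g}. enat (length ws))"

definition mw_length :: "('a, 'c) monoid_scheme \<Rightarrow> 'a set \<Rightarrow> ('a + int) list set \<Rightarrow> enat"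
  where "mw_length G S w = word_length (mixed_words G) (mw_const G ` S \<union> {mw_var G}) w"

definition mw_complexity :: "('a, 'c) monoid_scheme \<Rightarrow> 'a set \<Rightarrow> ('a + int) list set \<Rightarrow> enat"
  where "mw_complexity G S w =
    (INF g \<in> {g \<in> carrier G. mw_subst G g w \<noteq> \<one>\<^bsub>G\<^esub>}. word_length G S g)"

text \<open>
  For finite \<open>S\<close> and \<open>n \<ge> 1\<close> the supremum is over a finite set containing the variable, hence a
  maximum.
\<close>

definition MIF_growth :: "('a, 'c) monoid_scheme \<Rightarrow> 'a set \<Rightarrow> nat \<Rightarrow> enat"
  where "MIF_growth G S n =
    (SUP w \<in> {w \<in> carrier (mixed_words G). w \<noteq> \<one>\<^bsub>mixed_words G\<^esub> \<and> mw_length G S w \<le> enat n}.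
       mw_complexity G S w)"

definition sharply_MIF :: "('a, 'c) monoid_scheme \<Rightarrow> bool"
  where "sharply_MIF G \<longleftrightarrow>
    (\<exists>S. finite_generating_set G S \<and>
      (\<exists>C::real. C > 0 \<and>
        (\<forall>n\<ge>2. ereal_of_enat (MIF_growth G S n) \<le> ereal (C * ln (real n)))))"

section \<open>Well-definedness\<close>

lemma fp_words_simps [simp]:
  "[] \<in> fp_words G H"
  "Inl a \<in> A <+> B \<longleftrightarrow> a \<in> A"
  "Inr b \<in> A <+> B \<longleftrightarrow> b \<in> B"
  "x # u \<in> fp_words G H \<longleftrightarrow> x \<in> carrier G <+> carrier H \<and> u \<in> fp_words G H"
  "u @ v \<in> fp_words G H \<longleftrightarrow> u \<in> fp_words G H \<and> v \<in> fp_words G H"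
  by (auto simp: fp_words_def)

locale two_groups = G: group G + H: group H
  for G :: "('a, 'c) monoid_scheme" and H :: "('b, 'd) monoid_scheme"
begin

lemma fp_eq_words: "fp_eq G H u v \<Longrightarrow> u \<in> fp_words G H \<and> v \<in> fp_words G H"
  by (induction rule: fp_eq.induct) auto

lemma fp_eq_append_left: "fp_eq G H u v \<Longrightarrow> s \<in> fp_words G H \<Longrightarrow> fp_eq G H (s @ u) (s @ v)"
proof (induction rule: fp_eq.induct)
  case (multl u v a b)
  then show ?case using fp_eq.multl[of "s @ u" G H v a b] by simp
next
  case (multr u v a b)
  then show ?case using fp_eq.multr[of "s @ u" G H v a b] by simp
next
  case (onel u v)
  then show ?case using fp_eq.onel[of "s @ u" G H v] by simp
next
  case (oner u v)
  then show ?case using fp_eq.oner[of "s @ u" G H v] by simp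
qed (simp add: fp_eq.refl, (metis fp_eq.sym fp_eq.trans)+)

lemma fp_eq_append_right: "fp_eq G H u v \<Longrightarrow> s \<in> fp_words G H \<Longrightarrow> fp_eq G H (u @ s) (v @ s)"
proof (induction rule: fp_eq.induct)
  case (multl u v a b)
  then show ?case using fp_eq.multl[of u G H "v @ s" a b] by simp
next
  case (multr u v a b)
  then show ?case using fp_eq.multr[of u G H "v @ s" a b] by simp
next
  case (onel u v)
  then show ?case using fp_eq.onel[of u G H "v @ s"] by simp
next
  case (oner u v)
  then show ?case using fp_eq.oner[of u G H "v @ s"] by simp
qed (simp add: fp_eq.refl, (metis fp_eq.sym fp_eq.trans)+)

lemma fp_eq_append: "fp_eq G H u u' \<Longrightarrow> fp_eq G H v v' \<Longrightarrow> fp_eq G H (u @ v) (u' @ v')"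
  by (meson fp_eq.trans fp_eq_append_left fp_eq_append_right fp_eq_words)

lemma equiv_fp_rel: "equiv (fp_words G H) (fp_rel G H)"
proof (rule equivI)
  show "fp_rel G H \<subseteq> fp_words G H \<times> fp_words G H"
    using fp_eq_words by (auto simp: fp_rel_def)
  show "refl_on (fp_words G H) (fp_rel G H)"
    by (auto simp: refl_on_def fp_rel_def fp_eq.refl)
  show "sym (fp_rel G H)"
    by (auto simp: fp_rel_def intro!: symI dest: fp_eq.sym)
  show "trans (fp_rel G H)"
    by (rule transI) (simp add: fp_rel_def, rule fp_eq.trans)
qed

lemma fp_class_eq_iff:
  "u \<in> fp_words G H \<Longrightarrow> v \<in> fp_words G H \<Longrightarrow> fp_class G H u = fp_class G H v \<longleftrightarrow> fp_eq G H u v"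
  unfolding fp_class_def
  using eq_equiv_class_iff[OF equiv_fp_rel, of u v] by (simp add: fp_rel_def)

lemma in_fp_class_iff: "v \<in> fp_class G H u \<longleftrightarrow> fp_eq G H u v"
  by (simp add: fp_class_def fp_rel_def)

lemma carrier_free_product: "carrier (free_product G H) = fp_class G H ` fp_words G H"
  by (auto simp: free_product_def fp_class_def quotient_def)

lemma one_free_product: "\<one>\<^bsub>free_product G H\<^esub> = fp_class G H []"
  by (simp add: free_product_def)

lemma mult_free_product:
  assumes u: "u \<in> fp_words G H" and v: "v \<in> fp_words G H"
  shows "fp_class G H u \<otimes>\<^bsub>free_product G H\<^esub> fp_class G H v = fp_class G H (u @ v)"
proof -
  have eq: "fp_class G H (u' @ v') = fp_class G H (u @ v)"
    if "u' \<in> fp_class G H u" "v' \<in> fp_class G H v" for u' v'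
  proof -
    have "fp_eq G H (u @ v) (u' @ v')"
      using that by (auto simp: in_fp_class_iff intro: fp_eq_append)
    then show ?thesis
      by (metis fp_class_eq_iff fp_eq_words)
  qed
  have "u \<in> fp_class G H u" "v \<in> fp_class G H v"
    using u v by (auto simp: in_fp_class_iff intro: fp_eq.refl)
  then have "(\<Union>u'\<in>fp_class G H u. \<Union>v'\<in>fp_class G H v. fp_class G H (u' @ v')) =
      fp_class G H (u @ v)"
    using eq by blast
  then show ?thesis
    by (simp add: free_product_def)
qed

lemma letter_left_inverse:
  assumes "x \<in> carrier G <+> carrier H"
  shows "\<exists>y\<in>carrier G <+> carrier H. fp_eq G H [y, x] []"
  using assms
proof (cases x)
  case (Inl a)
  with assms have a: "a \<in> carrier G" by auto
  have "fp_eq G H [Inl (inv\<^bsub>G\<^esub> a), Inl a] [Inl \<one>\<^bsub>G\<^esub>]"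
    using fp_eq.multl[of "[]" G H "[]" "inv\<^bsub>G\<^esub> a" a] a by simp
  moreover have "fp_eq G H [Inl \<one>\<^bsub>G\<^esub>] []"
    using fp_eq.onel[of "[]" G H "[]"] by simp
  ultimately show ?thesis
    using a Inl by (intro bexI[of _ "Inl (inv\<^bsub>G\<^esub> a)"]) (auto intro: fp_eq.trans)
next
  case (Inr a)
  with assms have a: "a \<in> carrier H" by auto
  have "fp_eq G H [Inr (inv\<^bsub>H\<^esub> a), Inr a] [Inr \<one>\<^bsub>H\<^esub>]"
    using fp_eq.multr[of "[]" G H "[]" "inv\<^bsub>H\<^esub> a" a] a by simp
  moreover have "fp_eq G H [Inr \<one>\<^bsub>H\<^esub>] []"
    using fp_eq.oner[of "[]" G H "[]"] by simp
  ultimately show ?thesis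
    using a Inr by (intro bexI[of _ "Inr (inv\<^bsub>H\<^esub> a)"]) (auto intro: fp_eq.trans)
qed

lemma word_left_inverse:
  "u \<in> fp_words G H \<Longrightarrow> \<exists>v\<in>fp_words G H. fp_eq G H (v @ u) []"
proof (induction u)
  case Nil
  then show ?case by (intro bexI[of _ "[]"]) (auto intro: fp_eq.refl)
next
  case (Cons x u)
  then obtain v where v: "v \<in> fp_words G H" "fp_eq G H (v @ u) []" by auto
  obtain y where y: "y \<in> carrier G <+> carrier H" "fp_eq G H [y, x] []"
    using letter_left_inverse Cons.prems by auto
  have "fp_eq G H (v @ ([y, x] @ u)) (v @ ([] @ u))"
    using y v Cons.prems by (intro fp_eq_append_left fp_eq_append_right) auto
  then have "fp_eq G H ((v @ [y]) @ x # u) []"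
    using v by (auto intro: fp_eq.trans)
  then show ?case
    using v y by (intro bexI[of _ "v @ [y]"]) auto
qed

lemma group_free_product: "group (free_product G H)"
proof (rule groupI)
  fix A assume "A \<in> carrier (free_product G H)"
  then obtain u where u: "u \<in> fp_words G H" "A = fp_class G H u"
    by (auto simp: carrier_free_product)
  obtain v where v: "v \<in> fp_words G H" "fp_eq G H (v @ u) []"
    using word_left_inverse u by blast
  show "\<exists>B\<in>carrier (free_product G H). B \<otimes>\<^bsub>free_product G H\<^esub> A = \<one>\<^bsub>free_product G H\<^esub>"
    using u v by (intro bexI[of _ "fp_class G H v"])
      (auto simp: mult_free_product one_free_product carrier_free_product fp_class_eq_iff)
qed (auto simp: carrier_free_product one_free_product mult_free_product)

lemma fp_class_Cons:
  "x \<in> carrier G <+> carrier H \<Longrightarrow> u \<in> fp_words G H \<Longrightarrow>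
    fp_class G H (x # u) = fp_class G H [x] \<otimes>\<^bsub>free_product G H\<^esub> fp_class G H u"
  by (simp add: mult_free_product)

lemma inl_hom: "(\<lambda>a. fp_class G H [Inl a]) \<in> hom G (free_product G H)"
  using fp_eq.multl[of "[]" G H "[]", THEN fp_eq.sym]
  by (intro homI) (simp_all add: carrier_free_product mult_free_product fp_class_eq_iff)

lemma inr_hom: "(\<lambda>b. fp_class G H [Inr b]) \<in> hom H (free_product G H)"
  using fp_eq.multr[of "[]" G H "[]", THEN fp_eq.sym]
  by (intro homI) (simp_all add: carrier_free_product mult_free_product fp_class_eq_iff)

lemma hom_free_product_unique:
  assumes K: "group K"
    and h: "h \<in> hom (free_product G H) K" and k: "k \<in> hom (free_product G H) K"
    and inl: "\<And>a. a \<in> carrier G \<Longrightarrow> h (fp_class G H [Inl a]) = k (fp_class G H [Inl a])"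
    and inr: "\<And>b. b \<in> carrier H \<Longrightarrow> h (fp_class G H [Inr b]) = k (fp_class G H [Inr b])"
    and A: "A \<in> carrier (free_product G H)"
  shows "h A = k A"
proof -
  have "h (fp_class G H u) = k (fp_class G H u)" if "u \<in> fp_words G H" for u
    using that
  proof (induction u)
    case Nil
    then show ?case
      using hom_one[OF h group_free_product K] hom_one[OF k group_free_product K]
      by (simp add: one_free_product)
  next
    case (Cons x u)
    then have "fp_class G H [x] \<in> carrier (free_product G H)"
      "fp_class G H u \<in> carrier (free_product G H)"
      by (auto simp: carrier_free_product)
    moreover have "h (fp_class G H [x]) = k (fp_class G H [x])"
      using Cons.prems inl inr by auto
    ultimately show ?case
      using Cons fp_class_Cons[of x u] hom_mult[OF h] hom_mult[OF k] by simp
  qed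
  then show ?thesis using A by (auto simp: carrier_free_product)
qed

lemma hom_free_product_exists:
  assumes K: "group K" and f: "f \<in> hom G K" and g: "g \<in> hom H K"
  shows "\<exists>h\<in>hom (free_product G H) K. h \<in> extensional (carrier (free_product G H)) \<and>
    (\<forall>a\<in>carrier G. h (fp_class G H [Inl a]) = f a) \<and>
    (\<forall>b\<in>carrier H. h (fp_class G H [Inr b]) = g b)"
proof -
  interpret K: group K by (fact K)
  define ev where "ev u = foldr (\<lambda>x y. case_sum f g x \<otimes>\<^bsub>K\<^esub> y) u \<one>\<^bsub>K\<^esub>" for u
  have fc: "f a \<in> carrier K" if "a \<in> carrier G" for a using f that by (auto simp: hom_def)
  have gc: "g b \<in> carrier K" if "b \<in> carrier H" for b using g that by (auto simp: hom_def)
  have ev_simps: "ev [] = \<one>\<^bsub>K\<^esub>" "ev (x # u) = case_sum f g x \<otimes>\<^bsub>K\<^esub> ev u" for x u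
    by (auto simp: ev_def)
  have ev_closed: "ev u \<in> carrier K" if "u \<in> fp_words G H" for u
    using that by (induction u) (auto simp: ev_simps fc gc)
  have ev_append: "ev (u @ v) = ev u \<otimes>\<^bsub>K\<^esub> ev v"
    if "u \<in> fp_words G H" "v \<in> fp_words G H" for u v
    using that by (induction u) (auto simp: ev_simps fc gc ev_closed K.m_assoc)
  have ev_eq: "ev u = ev v" if "fp_eq G H u v" for u v
    using that
  proof (induction rule: fp_eq.induct)
    case (multl u v a b)
    then show ?case
      using hom_mult[OF f] by (simp add: ev_append ev_simps fc ev_closed K.m_assoc)
  next
    case (multr u v a b)
    then show ?case
      using hom_mult[OF g] by (simp add: ev_append ev_simps gc ev_closed K.m_assoc)
  next
    case (onel u v)
    then show ?case
      using hom_one[OF f G.is_group K] by (simp add: ev_append ev_simps ev_closed)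
  next
    case (oner u v)
    then show ?case
      using hom_one[OF g H.is_group K] by (simp add: ev_append ev_simps ev_closed)
  qed auto
  define h where "h = restrict (\<lambda>A. ev (SOME u. u \<in> A)) (carrier (free_product G H))"
  have h: "h (fp_class G H u) = ev u" if "u \<in> fp_words G H" for u
  proof -
    have "u \<in> fp_class G H u" using that by (auto simp: in_fp_class_iff intro: fp_eq.refl)
    then have "(SOME v. v \<in> fp_class G H u) \<in> fp_class G H u" by (rule someI)
    then have "ev (SOME v. v \<in> fp_class G H u) = ev u"
      using ev_eq by (simp add: in_fp_class_iff)
    then show ?thesis using that by (auto simp: h_def carrier_free_product)
  qed
  have "h \<in> hom (free_product G H) K"
    by (auto simp: hom_def carrier_free_product mult_free_product h ev_append ev_closed)
  then show ?thesis
    by (intro bexI[of _ h]) (auto simp: h ev_simps fc gc, simp add: h_def)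
qed

end

lemma mw_subst_ex1:
  assumes "group G" and g: "g \<in> carrier G"
  shows "\<exists>!h. h \<in> hom (mixed_words G) G \<and> h \<in> extensional (carrier (mixed_words G)) \<and>
    (\<forall>a\<in>carrier G. h (mw_const G a) = a) \<and> h (mw_var G) = g"
proof -
  interpret group G by fact
  interpret two_groups G integer_group
    by (intro two_groups.intro group_integer_group) fact
  obtain h where h: "h \<in> hom (mixed_words G) G" "h \<in> extensional (carrier (mixed_words G))"
    "\<forall>a\<in>carrier G. h (mw_const G a) = a"
    "\<forall>k. h (fp_class G integer_group [Inr k]) = g [^]\<^bsub>G\<^esub> (k::int)"
    using hom_free_product_exists[OF \<open>group G\<close>, of "\<lambda>a. a" "\<lambda>k. g [^]\<^bsub>G\<^esub> k"]
      hom_integer_group_pow[OF g]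
    by (auto simp: mw_const_def hom_def)
  show ?thesis
  proof (rule ex1I[of _ h])
    show "h \<in> hom (mixed_words G) G \<and> h \<in> extensional (carrier (mixed_words G)) \<and>
      (\<forall>a\<in>carrier G. h (mw_const G a) = a) \<and> h (mw_var G) = g"
      using h g by (simp add: mw_var_def int_pow_1)
  next
    fix k assume k: "k \<in> hom (mixed_words G) G \<and> k \<in> extensional (carrier (mixed_words G)) \<and>
      (\<forall>a\<in>carrier G. k (mw_const G a) = a) \<and> k (mw_var G) = g"
    have inr: "fp_class G integer_group [Inr i] = mw_var G [^]\<^bsub>mixed_words G\<^esub> i" for i :: int
      using hom_int_pow[OF inr_hom _ H.is_group group_free_product, of 1 i]
      by (simp add: mw_var_def)
    have var: "mw_var G \<in> carrier (mixed_words G)"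
      by (auto simp: mw_var_def carrier_free_product)
    have "k (fp_class G integer_group [Inr i]) = h (fp_class G integer_group [Inr i])" for i
      using hom_int_pow[OF _ var group_free_product \<open>group G\<close>, of k i] k h(4)
      by (simp add: inr)
    then have "k A = h A" if "A \<in> carrier (mixed_words G)" for A
      using hom_free_product_unique[OF \<open>group G\<close> _ h(1) _ _ that, of k] k h(3)
      by (simp add: mw_const_def)
    then show "k = h"
      using k h(2) by (intro extensionalityI) auto
  qed
qed

end

theory Submission
  imports Defs "HOL-Library.Countable_Set"
    "HOL-Combinatorics.Transposition" "HOL-Real_Asymp.Real_Asymp"
begin

text \<open>
  The group is generated by two permutations of the integers: the translation \<open>t\<close> by one and the
  product \<open>s\<close> of the transpositions of \<open>p\<close> and \<open>p + 1\<close>, where \<open>p\<close> ranges over a set \<open>P\<close>. Every finite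
  pattern of \<open>P\<close> recurs infinitely often, so nontrivial elements have infinite support. Some points
  of \<open>P\<close> are isolated by arbitrarily long gaps, so translates of \<open>s\<close> act on any finite window as single
  transpositions and the action is highly transitive. Together these rule out mixed identities.
  On the other hand, for infinitely many \<open>m\<close> every difference of two points of \<open>P\<close> has distance at
  least \<open>m / 2\<close> from \<open>m\<close>. Since an element of word length \<open>r\<close> moves points by at most a constant times
  \<open>r\<close>, the word \<open>[s, x t\<^sup>m s t\<^sup>-\<^sup>m x\<^sup>-\<^sup>1]\<close>, of length linear in \<open>m\<close>, vanishes on a ball of radius
  linear in \<open>m\<close>.
\<close>

section \<open>Highly transitive actions and mixed identities\<close>

text \<open>\<open>infinite_support\<close> gives faithfulness and leaves room to avoid any finite
  set of points; \<open>extends_injection\<close> lets a finite table of values of the variable be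
  prescribed freely.\<close>

locale highly_transitive_action = group G for G (structure) +
  fixes \<phi> :: "'a \<Rightarrow> 'x \<Rightarrow> 'x"
  assumes act_mult: "a \<in> carrier G \<Longrightarrow> b \<in> carrier G \<Longrightarrow> \<phi> (a \<otimes> b) = \<phi> a \<circ> \<phi> b"
    and act_one: "\<phi> \<one> = id"
    and infinite_support: "a \<in> carrier G \<Longrightarrow> a \<noteq> \<one> \<Longrightarrow> infinite {x. \<phi> a x \<noteq> x}"
    and extends_injection:
      "finite F \<Longrightarrow> inj_on f F \<Longrightarrow> \<exists>g\<in>carrier G. \<forall>x\<in>F. \<phi> g x = f x"
    and nontrivial: "\<exists>a\<in>carrier G. a \<noteq> \<one>"
begin

lemma act_inv_left: "a \<in> carrier G \<Longrightarrow> \<phi> (inv a) (\<phi> a x) = x"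
  using act_mult[of "inv a" a] act_one by (metis comp_apply id_apply inv_closed l_inv)

lemma act_inv_right: "a \<in> carrier G \<Longrightarrow> \<phi> a (\<phi> (inv a) x) = x"
  using act_inv_left[of "inv a"] by simp

lemma act_inj: "a \<in> carrier G \<Longrightarrow> inj (\<phi> a)"
  by (metis act_inv_left injI)

lemma infinite_points: "infinite (UNIV :: 'x set)"
  using nontrivial infinite_support by (metis finite_subset subset_UNIV)

text \<open>An orbit segment of \<open>k\<close> steps from \<open>y\<close> to \<open>z\<close> is
  written into the partial injection through fresh intermediate points. \<open>C\<close> holds
  points to be kept free: only the endpoints can newly enter it.\<close>

lemma path_nat_pow:
  fixes k :: nat
  assumes "finite F" "inj_on f F" "finite C" "y \<notin> F" "z \<notin> f ` F" "k > 0"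
  shows "\<exists>F' f'. finite F' \<and> inj_on f' F' \<and> (F' \<union> f' ` F') \<inter> C \<subseteq> F \<union> f ` F \<union> {y, z} \<and>
    (\<forall>g\<in>carrier G. (\<forall>x\<in>F'. \<phi> g x = f' x) \<longrightarrow>
      (\<forall>x\<in>F. \<phi> g x = f x) \<and> \<phi> (g [^] k) y = z)"
  using assms
proof (induction k arbitrary: F f y)
  case 0
  then show ?case by simp
next
  case (Suc k)
  show ?case
  proof (cases "k = 0")
    case True
    let ?F = "insert y F" and ?f = "f(y := z)"
    have "finite ?F" "inj_on ?f ?F"
      using Suc.prems by (auto simp: inj_on_def)
    moreover have "(?F \<union> ?f ` ?F) \<inter> C \<subseteq> F \<union> f ` F \<union> {y, z}" by auto
    moreover have "\<forall>g\<in>carrier G. (\<forall>x\<in>?F. \<phi> g x = ?f x) \<longrightarrow>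
        (\<forall>x\<in>F. \<phi> g x = f x) \<and> \<phi> (g [^] Suc k) y = z"
      using Suc.prems(4) True by (auto split: if_splits)
    ultimately show ?thesis by (intro exI conjI)
  next
    case False
    have "finite (F \<union> f ` F \<union> {y, z} \<union> C)" using Suc.prems by simp
    from ex_new_if_finite[OF infinite_points this]
    obtain y' where y': "y' \<notin> F \<union> f ` F \<union> {y, z} \<union> C" ..
    let ?F = "insert y F" and ?f = "f(y := y')"
    have im: "?f ` ?F = insert y' (f ` F)" using Suc.prems by auto
    have *: "finite ?F" "inj_on ?f ?F" "y' \<notin> ?F" "z \<notin> ?f ` ?F" "k > 0"
      using Suc.prems y' False by (auto simp: inj_on_def)
    from Suc.IH[OF *(1,2) Suc.prems(3) *(3,4,5)]
    obtain F' f' where F': "finite F'" "inj_on f' F'"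
      "(F' \<union> f' ` F') \<inter> C \<subseteq> ?F \<union> ?f ` ?F \<union> {y', z}"
      and g: "\<forall>g\<in>carrier G. (\<forall>x\<in>F'. \<phi> g x = f' x) \<longrightarrow>
        (\<forall>x\<in>?F. \<phi> g x = ?f x) \<and> \<phi> (g [^] k) y' = z"
      by (elim exE conjE)
    \<comment> \<open>The fresh point \<open>y'\<close> lies outside \<open>C\<close>, so it drops
      out of the bound given by the induction hypothesis.\<close>
    have "(F' \<union> f' ` F') \<inter> C \<subseteq> F \<union> f ` F \<union> {y, z}"
      using F'(3) y' unfolding im by blast
    moreover have "\<forall>g\<in>carrier G. (\<forall>x\<in>F'. \<phi> g x = f' x) \<longrightarrow>
        (\<forall>x\<in>F. \<phi> g x = f x) \<and> \<phi> (g [^] Suc k) y = z"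
    proof (intro ballI impI)
      fix h assume h: "h \<in> carrier G" "\<forall>x\<in>F'. \<phi> h x = f' x"
      show "(\<forall>x\<in>F. \<phi> h x = f x) \<and> \<phi> (h [^] Suc k) y = z"
        using g[rule_format, OF h(1)] h Suc.prems(4) by (auto simp: act_mult split: if_splits)
    qed
    ultimately show ?thesis using F'(1,2) by (intro exI conjI)
  qed
qed

text \<open>A negative power follows a positive path from \<open>z\<close> back to \<open>y\<close>.
  Both endpoints avoid arguments and values of \<open>f\<close>, so that either direction is
  available.\<close>

lemma path_int_pow:
  fixes k :: int
  assumes "finite F" "inj_on f F" "finite C" "k \<noteq> 0"
    and "y \<notin> F \<union> f ` F" "z \<notin> F \<union> f ` F"
  shows "\<exists>F' f'. finite F' \<and> inj_on f' F' \<and> (F' \<union> f' ` F') \<inter> C \<subseteq> F \<union> f ` F \<union> {y, z} \<and>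
    (\<forall>g\<in>carrier G. (\<forall>x\<in>F'. \<phi> g x = f' x) \<longrightarrow>
      (\<forall>x\<in>F. \<phi> g x = f x) \<and> \<phi> (g [^] k) y = z)"
proof (cases "k > 0")
  case True
  have "0 < nat k" "y \<notin> F" "z \<notin> f ` F" using True assms by auto
  note path = path_nat_pow[OF assms(1-3) this(2,3,1)]
  have "g [^] k = g [^] nat k" for g using True by (simp only: int_pow_def2) simp
  with path show ?thesis by (simp only:)
next
  case False
  then have pow: "g [^] k = inv (g [^] nat (- k))" for g
    using assms(4) by (simp only: int_pow_def2) simp
  have inv: "\<phi> (g [^] k) y = z"
    if "g \<in> carrier G" "\<phi> (g [^] nat (- k)) z = y" for g
    unfolding pow using that act_inv_left[OF nat_pow_closed] by metis
  have "0 < nat (- k)" "z \<notin> F" "y \<notin> f ` F" using False assms by auto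
  from path_nat_pow[OF assms(1-3) this(2,3,1)]
  obtain F' f' where F': "finite F'" "inj_on f' F'"
      "(F' \<union> f' ` F') \<inter> C \<subseteq> F \<union> f ` F \<union> {z, y}"
    and g: "\<forall>g\<in>carrier G. (\<forall>x\<in>F'. \<phi> g x = f' x) \<longrightarrow>
        (\<forall>x\<in>F. \<phi> g x = f x) \<and> \<phi> (g [^] nat (- k)) z = y"
    by (elim exE conjE)
  have "(F' \<union> f' ` F') \<inter> C \<subseteq> F \<union> f ` F \<union> {y, z}"
    using F'(3) by (simp add: insert_commute)
  moreover have "\<forall>g\<in>carrier G. (\<forall>x\<in>F'. \<phi> g x = f' x) \<longrightarrow>
      (\<forall>x\<in>F. \<phi> g x = f x) \<and> \<phi> (g [^] k) y = z"
    using g inv by blast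
  ultimately show ?thesis using F'(1,2) by (intro exI conjI)
qed

section \<open>Evaluation of reduced words\<close>

definition eval_word :: "'a \<Rightarrow> ('a + int) list \<Rightarrow> 'a"
  where "eval_word g u = foldr (\<lambda>l b. case_sum (\<lambda>a. a) (\<lambda>k. g [^] k) l \<otimes> b) u \<one>"

lemma eval_word_simps [simp]:
  "eval_word g [] = \<one>"
  "eval_word g (Inl a # u) = a \<otimes> eval_word g u"
  "eval_word g (Inr k # u) = g [^] k \<otimes> eval_word g u"
  by (simp_all add: eval_word_def)

lemma eval_word_closed:
  "g \<in> carrier G \<Longrightarrow> u \<in> fp_words G integer_group \<Longrightarrow> eval_word g u \<in> carrier G"
proof (induction u)
  case (Cons l u)
  then show ?case by (cases l) auto
qed simp

fun reduced :: "('a + int) list \<Rightarrow> bool" where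
  "reduced [] \<longleftrightarrow> True"
| "reduced (Inl a # u) \<longleftrightarrow> a \<in> carrier G \<and> a \<noteq> \<one> \<and> (\<forall>b v. u \<noteq> Inl b # v) \<and> reduced u"
| "reduced (Inr k # u) \<longleftrightarrow> k \<noteq> 0 \<and> (\<forall>b v. u \<noteq> Inr b # v) \<and> reduced u"

lemma reduced_words: "reduced u \<Longrightarrow> u \<in> fp_words G integer_group"
  by (induction u rule: reduced.induct) auto

text \<open>
  The trajectory of \<open>x0\<close> under a reduced word is prescribed letter by letter; since supports are
  infinite, the point reached before a constant can be chosen so that the constant moves it to a
  point on which the variable is still unconstrained.
\<close>

lemma trajectory:
  assumes "reduced u" "\<forall>b v. u \<noteq> Inl b # v" "a \<in> carrier G" "a \<noteq> \<one>"
  shows "\<exists>x0 z F f. finite F \<and> inj_on f F \<and> \<phi> a z \<notin> F \<union> f ` F \<and> \<phi> a z \<noteq> x0 \<and>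
    (u \<noteq> [] \<longrightarrow> z \<noteq> x0) \<and>
    (\<forall>g\<in>carrier G. (\<forall>x\<in>F. \<phi> g x = f x) \<longrightarrow> \<phi> (eval_word g u) x0 = z)"
  using assms
\<comment> \<open>The constant \<open>a\<close> is the letter that acts next, to the left of
  \<open>u\<close>. A round removes a power and the constant to its right, hence the induction on
  length.\<close>
proof (induction u arbitrary: a rule: measure_induct_rule[of length])
  case (less u)
  show ?case
  proof (cases u)
    case Nil
    have "{x. \<phi> a x \<noteq> x} \<noteq> {}"
      using infinite_support[OF less.prems(3,4)] by (metis finite.emptyI)
    then obtain x where "\<phi> a x \<noteq> x" by auto
    then show ?thesis
      using Nil
      by (intro exI[of _ x] exI[of _ x] exI[of _ "{}"] exI[of _ id]) (auto simp: act_one)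
  next
    case (Cons l v)
    then obtain k where l: "l = Inr k" and k: "k \<noteq> 0" and v: "reduced v" "\<forall>b w. v \<noteq> Inr b # w"
      using less.prems by (cases l) auto
    \<comment> \<open>The rest of the word ends at a point \<open>y\<close> on which the variable is
      still unconstrained; for an empty rest any point serves.\<close>
    have "\<exists>x0 y F f. finite F \<and> inj_on f F \<and> y \<notin> F \<union> f ` F \<and>
      (\<forall>g\<in>carrier G. (\<forall>x\<in>F. \<phi> g x = f x) \<longrightarrow> \<phi> (eval_word g v) x0 = y)"
    proof (cases v)
      case Nil
      then show ?thesis
        by (intro exI[of _ undefined] exI[of _ undefined] exI[of _ "{}"] exI[of _ id])
          (auto simp: act_one)
    next
      case (Cons l' v')
      then obtain b where b: "l' = Inl b" using v by (cases l') auto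
      have v': "b \<in> carrier G" "b \<noteq> \<one>" "reduced v'" "\<forall>c w. v' \<noteq> Inl c # w"
        using v Cons b by auto
      have "length v' < length u" using Cons \<open>u = l # v\<close> by simp
      from less.IH[OF this v'(3,4,1,2)]
      obtain x0 z F f where F: "finite F" "inj_on f F" "\<phi> b z \<notin> F \<union> f ` F"
        and g: "\<forall>g\<in>carrier G. (\<forall>x\<in>F. \<phi> g x = f x) \<longrightarrow> \<phi> (eval_word g v') x0 = z"
        by (elim exE conjE)
      have "\<forall>g\<in>carrier G. (\<forall>x\<in>F. \<phi> g x = f x) \<longrightarrow> \<phi> (eval_word g v) x0 = \<phi> b z"
        using v' Cons b g eval_word_closed reduced_words[OF v'(3)] by (simp add: act_mult)
      with F show ?thesis by (intro exI conjI)
    qed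
    then obtain x0 y F f where F: "finite F" "inj_on f F" "y \<notin> F \<union> f ` F"
      and g: "\<forall>g\<in>carrier G. (\<forall>x\<in>F. \<phi> g x = f x) \<longrightarrow> \<phi> (eval_word g v) x0 = y"
      by (elim exE conjE)
    \<comment> \<open>Both \<open>z\<close> and its image under \<open>a\<close> have to avoid
      \<open>?B\<close>. As \<open>a\<close> acts injectively, this excludes only finitely many
      points of its infinite support.\<close>
    let ?B = "F \<union> f ` F \<union> {x0, y}"
    have "finite (?B \<union> \<phi> a -` ?B)"
      using F act_inj[OF less.prems(3)] by (intro finite_UnI finite_vimageI) auto
    then have "infinite ({x. \<phi> a x \<noteq> x} - (?B \<union> \<phi> a -` ?B))"
      using infinite_support[OF less.prems(3,4)] by simp
    then have "{x. \<phi> a x \<noteq> x} - (?B \<union> \<phi> a -` ?B) \<noteq> {}"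
      by (metis finite.emptyI)
    then obtain z where z: "\<phi> a z \<noteq> z" "z \<notin> ?B" "\<phi> a z \<notin> ?B" by blast
    \<comment> \<open>The image of \<open>z\<close> under \<open>a\<close> is the protected point of
      the path: it differs from both endpoints, so it stays free for the next power.\<close>
    have "finite {\<phi> a z}" "z \<notin> F \<union> f ` F" using z by auto
    from path_int_pow[OF F(1,2) this(1) k F(3) this(2)]
    obtain F' f' where F': "finite F'" "inj_on f' F'"
      "(F' \<union> f' ` F') \<inter> {\<phi> a z} \<subseteq> F \<union> f ` F \<union> {y, z}"
      and g': "\<forall>g\<in>carrier G. (\<forall>x\<in>F'. \<phi> g x = f' x) \<longrightarrow>
        (\<forall>x\<in>F. \<phi> g x = f x) \<and> \<phi> (g [^] k) y = z"
      by (elim exE conjE)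
    have "\<forall>g\<in>carrier G. (\<forall>x\<in>F'. \<phi> g x = f' x) \<longrightarrow> \<phi> (eval_word g u) x0 = z"
    proof (intro ballI impI)
      fix h assume h: "h \<in> carrier G" "\<forall>x\<in>F'. \<phi> h x = f' x"
      then have "\<phi> (eval_word h v) x0 = y" "\<phi> (h [^] k) y = z" using g g' by simp_all
      then show "\<phi> (eval_word h u) x0 = z"
        using h(1) Cons l reduced_words[OF v(1)] eval_word_closed by (simp add: act_mult)
    qed
    moreover have "\<phi> a z \<notin> F' \<union> f' ` F'" "\<phi> a z \<noteq> x0" "u \<noteq> [] \<longrightarrow> z \<noteq> x0"
      using F'(3) z by auto
    ultimately show ?thesis using F'(1,2) by (intro exI conjI)
  qed
qed

lemma reduced_eval_nontrivial:
  assumes u: "reduced u" "u \<noteq> []"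
  shows "\<exists>g\<in>carrier G. eval_word g u \<noteq> \<one>"
proof -
  \<comment> \<open>A dummy for words that begin with a power, since \<open>trajectory\<close> asks
    for a constant to the left of the word.\<close>
  obtain a0 where a0: "a0 \<in> carrier G" "a0 \<noteq> \<one>" using nontrivial by blast
  have "\<exists>x0 z F f. finite F \<and> inj_on f F \<and> z \<noteq> x0 \<and>
    (\<forall>g\<in>carrier G. (\<forall>x\<in>F. \<phi> g x = f x) \<longrightarrow> \<phi> (eval_word g u) x0 = z)"
  proof (cases "\<exists>b v. u = Inl b # v")
    case True
    then obtain b v where b: "u = Inl b # v" by blast
    then have v: "b \<in> carrier G" "b \<noteq> \<one>" "reduced v" "\<forall>c w. v \<noteq> Inl c # w" using u by auto
    from trajectory[OF v(3,4,1,2)]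
    obtain x0 z F f where F: "finite F" "inj_on f F" "\<phi> b z \<noteq> x0"
      and g: "\<forall>g\<in>carrier G. (\<forall>x\<in>F. \<phi> g x = f x) \<longrightarrow> \<phi> (eval_word g v) x0 = z"
      by (elim exE conjE)
    have "\<forall>g\<in>carrier G. (\<forall>x\<in>F. \<phi> g x = f x) \<longrightarrow> \<phi> (eval_word g u) x0 = \<phi> b z"
      using v b g eval_word_closed reduced_words[OF v(3)] by (simp add: act_mult)
    with F show ?thesis by (intro exI conjI)
  next
    case False
    then have "\<forall>b v. u \<noteq> Inl b # v" by blast
    from trajectory[OF u(1) this a0]
    obtain x0 z F f where F: "finite F" "inj_on f F" "u \<noteq> [] \<longrightarrow> z \<noteq> x0"
      "\<forall>g\<in>carrier G. (\<forall>x\<in>F. \<phi> g x = f x) \<longrightarrow> \<phi> (eval_word g u) x0 = z"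
      by (elim exE conjE)
    with u(2) show ?thesis by (intro exI conjI) simp_all
  qed
  then obtain x0 z F f where F: "finite F" "inj_on f F" "z \<noteq> x0"
    "\<forall>g\<in>carrier G. (\<forall>x\<in>F. \<phi> g x = f x) \<longrightarrow> \<phi> (eval_word g u) x0 = z"
    by (elim exE conjE)
  obtain g where g: "g \<in> carrier G" "\<forall>x\<in>F. \<phi> g x = f x"
    using extends_injection[OF F(1,2)] ..
  then have "\<phi> (eval_word g u) x0 = z" using F(4) by blast
  then have "eval_word g u \<noteq> \<one>" using F(3) act_one by auto
  then show ?thesis using g(1) by blast
qed

end

section \<open>Words in the free product with the integers\<close>

context group
begin

lemma two_groups_int: "two_groups G integer_group"
  by (intro two_groups.intro group_integer_group) (rule is_group)

lemma group_mixed_words: "group (mixed_words G)"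
  using two_groups.group_free_product[OF two_groups_int] .

lemma mw_var_closed: "mw_var G \<in> carrier (mixed_words G)"
  by (auto simp: mw_var_def two_groups.carrier_free_product[OF two_groups_int])

lemma mw_const_hom: "mw_const G \<in> hom G (mixed_words G)"
  using two_groups.inl_hom[OF two_groups_int] by (simp add: mw_const_def[abs_def])

lemma mw_subst_spec:
  assumes "g \<in> carrier G"
  shows "mw_subst G g \<in> hom (mixed_words G) G"
    and "a \<in> carrier G \<Longrightarrow> mw_subst G g (mw_const G a) = a"
    and "mw_subst G g (mw_var G) = g"
  using theI'[OF mw_subst_ex1[OF is_group assms]] by (auto simp: mw_subst_def)

lemma mw_subst_pow:
  assumes g: "g \<in> carrier G"
  shows "mw_subst G g (fp_class G integer_group [Inr k]) = g [^] (k :: int)"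
proof -
  interpret two_groups G integer_group by (rule two_groups_int)
  have "fp_class G integer_group [Inr k] = mw_var G [^]\<^bsub>mixed_words G\<^esub> k"
    using hom_int_pow[OF inr_hom _ H.is_group group_free_product, of 1 k]
    by (simp add: mw_var_def)
  then show ?thesis
    using hom_int_pow[OF mw_subst_spec(1)[OF g] mw_var_closed group_free_product is_group, of k]
      mw_subst_spec(3)[OF g] by simp
qed

end

section \<open>Nontrivial mixed words have nontrivial values\<close>

lemma (in highly_transitive_action) mw_subst_eval:
  assumes g: "g \<in> carrier G" and u: "u \<in> fp_words G integer_group"
  shows "mw_subst G g (fp_class G integer_group u) = eval_word g u"
proof -
  interpret two_groups G integer_group by (rule two_groups_int)
  show ?thesis
    using u
  proof (induction u)
    case Nil
    then show ?case
      using hom_one[OF mw_subst_spec(1)[OF g] group_mixed_words is_group]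
      by (simp add: one_free_product)
  next
    case (Cons l u)
    then have *: "fp_class G integer_group [l] \<in> carrier (mixed_words G)"
      "fp_class G integer_group u \<in> carrier (mixed_words G)"
      by (auto simp: carrier_free_product)
    have "mw_subst G g (fp_class G integer_group (l # u)) =
        mw_subst G g (fp_class G integer_group [l]) \<otimes> eval_word g u"
      using Cons fp_class_Cons[of l u] hom_mult[OF mw_subst_spec(1)[OF g] *] by simp
    then show ?case
      using Cons.prems g mw_subst_pow mw_subst_spec(2)[OF g]
      by (cases l) (auto simp: mw_const_def)
  qed
qed

text \<open>Every defect is repaired by one defining relation that shortens the word: deletion of an
  identity letter, or multiplication of two neighbours from the same factor.\<close>

lemma (in highly_transitive_action) shortest_word_reduced:
  assumes "u \<in> fp_words G integer_group"
    and "\<And>v. fp_eq G integer_group u v \<Longrightarrow> length u \<le> length v"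
  shows "reduced u"
proof -
  interpret two_groups G integer_group by (rule two_groups_int)
  show ?thesis
    using assms
  proof (induction u)
    case (Cons l u)
    have u: "u \<in> fp_words G integer_group" using Cons.prems by simp
    have "length u \<le> length v" if "fp_eq G integer_group u v" for v
      using Cons.prems(2)[of "l # v"] Cons.prems(1) fp_eq_append_left[OF that, of "[l]"] by simp
    then have red: "reduced u" using Cons.IH u by blast
    have short: False if "fp_eq G integer_group (l # u) v" "length v \<le> length u" for v
      using Cons.prems(2)[OF that(1)] that(2) by simp
    show ?case
    proof (cases l)
      case (Inl a)
      have "a \<noteq> \<one>"
        using fp_eq.onel[of "[]" G integer_group u] u short[of u] Inl by auto
      moreover have "u \<noteq> Inl b # v" for b v
        using fp_eq.multl[of "[]" G integer_group v a b] u short[of "Inl (a \<otimes> b) # v"] Inl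
          Cons.prems(1) by auto
      ultimately show ?thesis using red Inl Cons.prems(1) by auto
    next
      case (Inr k)
      have "k \<noteq> 0"
        using fp_eq.oner[of "[]" G integer_group u] u short[of u] Inr by auto
      moreover have "u \<noteq> Inr b # v" for b v
        using fp_eq.multr[of "[]" G integer_group v k b] u short[of "Inr (k + b) # v"] Inr
          Cons.prems(1) by auto
      ultimately show ?thesis using red Inr Cons.prems(1) by auto
    qed
  qed simp
qed

lemma (in highly_transitive_action) MIF: "MIF G"
  unfolding MIF_def
proof
  assume "\<exists>w. mixed_identity G w"
  then obtain w where w: "w \<in> carrier (mixed_words G)" "w \<noteq> \<one>\<^bsub>mixed_words G\<^esub>"
    "\<And>g. g \<in> carrier G \<Longrightarrow> mw_subst G g w = \<one>"
    by (auto simp: mixed_identity_def)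
  interpret two_groups G integer_group by (rule two_groups_int)
  obtain u0 where u0: "u0 \<in> fp_words G integer_group" "w = fp_class G integer_group u0"
    using w(1) by (auto simp: carrier_free_product)
  \<comment> \<open>A shortest representative is reduced, and it is nonempty because
    \<open>w\<close> is not the identity.\<close>
  define u where "u = arg_min length (\<lambda>v. fp_eq G integer_group u0 v)"
  have refl: "fp_eq G integer_group u0 u0" using u0 by (intro fp_eq.refl)
  have u: "fp_eq G integer_group u0 u"
    unfolding u_def using refl by (rule arg_min_natI)
  have least: "length u \<le> length v" if "fp_eq G integer_group u0 v" for v
    unfolding u_def using that by (rule arg_min_nat_le)
  have min: "length u \<le> length v" if "fp_eq G integer_group u v" for v
    using least fp_eq.trans[OF u that] .
  have fpw: "u \<in> fp_words G integer_group" using u fp_eq_words by blast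
  then have wu: "w = fp_class G integer_group u"
    using u u0 by (simp add: fp_class_eq_iff)
  have "reduced u"
    using fpw min by (rule shortest_word_reduced)
  moreover have "u \<noteq> []" using w(2) wu by (auto simp: one_free_product)
  ultimately show False
    using reduced_eval_nontrivial w(3) mw_subst_eval fpw wu by metis
qed

section \<open>Word length\<close>

context group
begin

abbreviation prod_word :: "'a list \<Rightarrow> 'a"
  where "prod_word ws \<equiv> foldr (\<otimes>) ws \<one>"

lemma prod_word_closed: "set ws \<subseteq> carrier G \<Longrightarrow> prod_word ws \<in> carrier G"
  by (induction ws) auto

lemma prod_word_append:
  "set us \<subseteq> carrier G \<Longrightarrow> set vs \<subseteq> carrier G \<Longrightarrow>
    prod_word (us @ vs) = prod_word us \<otimes> prod_word vs"
  by (induction us) (auto simp: prod_word_closed m_assoc simp del: foldr_append)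

lemma prod_word_rev_inv:
  "set ws \<subseteq> carrier G \<Longrightarrow> prod_word (rev (map (m_inv G) ws)) = inv (prod_word ws)"
proof (induction ws)
  case (Cons w ws)
  have "set (rev (map (m_inv G) ws)) \<subseteq> carrier G" using Cons.prems by auto
  then have "prod_word (rev (map (m_inv G) ws) @ [inv w]) = inv (prod_word ws) \<otimes> inv w"
    using Cons by (subst prod_word_append) auto
  then show ?case
    using Cons.prems by (simp add: inv_mult_group prod_word_closed del: foldr_append)
qed simp

text \<open>An infimum over a nonempty family in \<open>enat\<close> is attained, and the empty
  family has infimum infinity. Finite bounds thus become witnessing words, through which the length
  estimates below are proved.\<close>

lemma word_length_le_iff:
  "word_length G S g \<le> enat n \<longleftrightarrow>
    (\<exists>ws. set ws \<subseteq> S \<union> m_inv G ` S \<and> prod_word ws = g \<and> length ws \<le> n)"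
  (is "?L \<longleftrightarrow> ?R")
proof
  let ?W = "{ws. set ws \<subseteq> S \<union> m_inv G ` S \<and> prod_word ws = g}"
  assume L: ?L
  have "?W \<noteq> {}"
  proof
    assume "?W = {}"
    then have "word_length G S g = \<infinity>"
      by (simp only: word_length_def image_empty Inf_empty top_enat_def)
    then show False using L by simp
  qed
  then obtain ws0 where "ws0 \<in> ?W" by blast
  then have "(INF ws\<in>?W. enat (length ws)) \<in> (\<lambda>ws. enat (length ws)) ` ?W"
    by (intro wellorder_InfI[of "enat (length ws0)"]) (rule imageI)
  then show ?R using L by (auto simp: word_length_def)
next
  assume ?R
  then show ?L by (auto simp: word_length_def intro!: INF_lower2)
qed

lemma word_length_mult:
  assumes S: "S \<subseteq> carrier G" and "word_length G S g \<le> enat m" "word_length G S h \<le> enat n"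
  shows "word_length G S (g \<otimes> h) \<le> enat (m + n)"
proof -
  have SS: "S \<union> m_inv G ` S \<subseteq> carrier G" using S by auto
  obtain us vs where "set us \<subseteq> S \<union> m_inv G ` S" "prod_word us = g" "length us \<le> m"
    "set vs \<subseteq> S \<union> m_inv G ` S" "prod_word vs = h" "length vs \<le> n"
    using assms by (auto simp: word_length_le_iff)
  then show ?thesis
    unfolding word_length_le_iff using SS prod_word_append[of us vs]
    by (intro exI[of _ "us @ vs"]) (auto simp del: foldr_append)
qed

lemma word_length_inv:
  assumes S: "S \<subseteq> carrier G" and "word_length G S g \<le> enat n"
  shows "word_length G S (inv g) \<le> enat n"
proof -
  have SS: "S \<union> m_inv G ` S \<subseteq> carrier G" using S by auto
  obtain ws where ws: "set ws \<subseteq> S \<union> m_inv G ` S" "prod_word ws = g" "length ws \<le> n"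
    using assms by (auto simp: word_length_le_iff)
  moreover have "set (rev (map (m_inv G) ws)) \<subseteq> S \<union> m_inv G ` S"
    using ws(1) S by (fastforce simp: image_iff)
  moreover have "prod_word (rev (map (m_inv G) ws)) = inv g"
    using prod_word_rev_inv ws SS by blast
  ultimately show ?thesis
    unfolding word_length_le_iff by (intro exI[of _ "rev (map (m_inv G) ws)"]) simp
qed

lemma word_length_one: "word_length G S \<one> \<le> enat 0"
  unfolding word_length_le_iff by auto

lemma word_length_generator: "S \<subseteq> carrier G \<Longrightarrow> s \<in> S \<Longrightarrow> word_length G S s \<le> enat 1"
  unfolding word_length_le_iff by (intro exI[of _ "[s]"]) auto

lemma word_length_pow:
  assumes S: "S \<subseteq> carrier G" and "word_length G S g \<le> enat n"
  shows "word_length G S (g [^] (m::nat)) \<le> enat (m * n)"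
proof (induction m)
  case 0
  then show ?case using word_length_one by (simp add: zero_enat_def)
next
  case (Suc m)
  then show ?case using word_length_mult[OF S Suc assms(2)] by (simp add: add.commute)
qed

lemma word_length_finite:
  assumes S: "S \<subseteq> carrier G" and "g \<in> generate G S"
  shows "\<exists>n. word_length G S g \<le> enat n"
  using assms(2)
proof induction
  case one
  then show ?case using word_length_one by blast
next
  case (incl h)
  then show ?case using word_length_generator[OF S] by blast
next
  case (inv h)
  then show ?case using word_length_generator[OF S] word_length_inv[OF S] by blast
next
  case (eng h1 h2)
  then show ?case using word_length_mult[OF S] by blast
qed

text \<open>Applying \<open>mw_const\<close> letter by letter turns a word for \<open>g\<close> into
  a word of the same length in the free product.\<close>

lemma word_length_mw_const:
  assumes S: "S \<subseteq> carrier G" and "word_length G S g \<le> enat n"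
  shows "mw_length G S (mw_const G g) \<le> enat n"
proof -
  interpret M: group "mixed_words G" by (rule group_mixed_words)
  interpret c: group_hom G "mixed_words G" "mw_const G"
    by unfold_locales (rule mw_const_hom)
  obtain ws where ws: "set ws \<subseteq> S \<union> m_inv G ` S" "prod_word ws = g" "length ws \<le> n"
    using assms by (auto simp: word_length_le_iff)
  have "set ws \<subseteq> carrier G" using ws S by auto
  then have "M.prod_word (map (mw_const G) ws) = mw_const G (prod_word ws)"
    by (induction ws) (simp_all add: prod_word_closed)
  moreover have "set (map (mw_const G) ws) \<subseteq>
      mw_const G ` S \<union> m_inv (mixed_words G) ` (mw_const G ` S)"
    using ws(1) S c.hom_inv by (fastforce simp: image_iff)
  ultimately show ?thesis
    unfolding mw_length_def M.word_length_le_iff using ws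
    by (intro exI[of _ "map (mw_const G) ws"]) auto
qed

end

section \<open>Commutators with a conjugate of a constant by the variable\<close>

context group
begin

definition conj_comm_word :: "'a \<Rightarrow> 'a \<Rightarrow> ('a + int) list set"
  where "conj_comm_word a b =
    (let y = mw_var G \<otimes>\<^bsub>mixed_words G\<^esub> mw_const G b \<otimes>\<^bsub>mixed_words G\<^esub> inv\<^bsub>mixed_words G\<^esub> mw_var G
     in mw_const G a \<otimes>\<^bsub>mixed_words G\<^esub> y \<otimes>\<^bsub>mixed_words G\<^esub>
        inv\<^bsub>mixed_words G\<^esub> mw_const G a \<otimes>\<^bsub>mixed_words G\<^esub> inv\<^bsub>mixed_words G\<^esub> y)"

lemma mw_const_closed: "a \<in> carrier G \<Longrightarrow> mw_const G a \<in> carrier (mixed_words G)"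
  using mw_const_hom by (auto simp: hom_def)

lemma conj_comm_word_closed:
  assumes "a \<in> carrier G" "b \<in> carrier G"
  shows "conj_comm_word a b \<in> carrier (mixed_words G)"
proof -
  interpret M: group "mixed_words G" by (rule group_mixed_words)
  show ?thesis
    using assms by (simp add: conj_comm_word_def Let_def mw_const_closed mw_var_closed)
qed

lemma conj_comm_word_length:
  assumes S: "S \<subseteq> carrier G"
    and "word_length G S a \<le> enat m" "word_length G S b \<le> enat n"
  shows "mw_length G S (conj_comm_word a b) \<le> enat (2 * m + 2 * n + 4)"
proof -
  interpret M: group "mixed_words G" by (rule group_mixed_words)
  let ?T = "mw_const G ` S \<union> {mw_var G}"
  have T: "?T \<subseteq> carrier (mixed_words G)"
    using S mw_const_closed mw_var_closed by auto
  have a: "word_length (mixed_words G) ?T (mw_const G a) \<le> enat m"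
    and b: "word_length (mixed_words G) ?T (mw_const G b) \<le> enat n"
    using word_length_mw_const[OF S] assms by (simp_all add: mw_length_def)
  have x: "word_length (mixed_words G) ?T (mw_var G) \<le> enat 1"
    using M.word_length_generator[OF T] by simp
  note y = M.word_length_mult[OF T M.word_length_mult[OF T x b] M.word_length_inv[OF T x]]
  \<comment> \<open>The commutator contains \<open>a\<close> and the conjugate of \<open>b\<close>
    twice each up to inversion; the conjugate costs two extra letters for the variable.\<close>
  have eq: "m + (1 + n + 1) + m + (1 + n + 1) = 2 * m + 2 * n + 4" by simp
  show ?thesis
    using M.word_length_mult[OF T M.word_length_mult[OF T M.word_length_mult[OF T a y]
        M.word_length_inv[OF T a]] M.word_length_inv[OF T y]]
    unfolding mw_length_def conj_comm_word_def Let_def eq .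
qed

lemma conj_comm_word_subst:
  assumes g: "g \<in> carrier G" and ab: "a \<in> carrier G" "b \<in> carrier G"
  shows "mw_subst G g (conj_comm_word a b) = \<one> \<longleftrightarrow>
    a \<otimes> (g \<otimes> b \<otimes> inv g) = (g \<otimes> b \<otimes> inv g) \<otimes> a"
proof -
  interpret M: group "mixed_words G" by (rule group_mixed_words)
  interpret h: group_hom "mixed_words G" G "mw_subst G g"
    by unfold_locales (rule mw_subst_spec(1)[OF g])
  define y where "y = g \<otimes> b \<otimes> inv g"
  have y: "y \<in> carrier G" using g ab by (simp add: y_def)
  have "mw_subst G g (conj_comm_word a b) = a \<otimes> y \<otimes> inv a \<otimes> inv y"
    using g ab
    by (simp add: conj_comm_word_def Let_def y_def mw_const_closed mw_var_closed mw_subst_spec)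
  also have "\<dots> = (a \<otimes> y) \<otimes> inv (y \<otimes> a)"
    using ab y by (simp add: inv_mult_group m_assoc)
  also have "\<dots> = \<one> \<longleftrightarrow> a \<otimes> y = y \<otimes> a"
    using ab y by (metis inv_closed m_closed inv_equality inv_inv r_inv)
  finally show ?thesis by (simp add: y_def)
qed

text \<open>Reduces lower bounds on growth to commutation inside \<open>G\<close>. One noncommuting
  \<open>g\<close> certifies that the commutator word is nontrivial, and commutation on the ball of
  radius \<open>r\<close> pushes its complexity beyond \<open>r\<close>.\<close>

lemma MIF_growth_ge:
  assumes S: "S \<subseteq> carrier G" and ab: "a \<in> carrier G" "b \<in> carrier G"
    and len: "word_length G S a \<le> enat m" "word_length G S b \<le> enat n"
    and nontriv: "\<exists>g\<in>carrier G. a \<otimes> (g \<otimes> b \<otimes> inv g) \<noteq> (g \<otimes> b \<otimes> inv g) \<otimes> a"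
    and triv: "\<And>g. g \<in> carrier G \<Longrightarrow> word_length G S g \<le> enat r \<Longrightarrow>
      a \<otimes> (g \<otimes> b \<otimes> inv g) = (g \<otimes> b \<otimes> inv g) \<otimes> a"
  shows "enat r \<le> MIF_growth G S (2 * m + 2 * n + 4)"
proof -
  let ?w = "conj_comm_word a b"
  obtain g where g: "g \<in> carrier G" "mw_subst G g ?w \<noteq> \<one>"
    using nontriv ab conj_comm_word_subst by blast
  have "mw_subst G g \<one>\<^bsub>mixed_words G\<^esub> = \<one>"
    using hom_one[OF mw_subst_spec(1)[OF g(1)] group_mixed_words is_group] .
  then have "?w \<noteq> \<one>\<^bsub>mixed_words G\<^esub>" using g by metis
  moreover have "enat r \<le> mw_complexity G S ?w"
    unfolding mw_complexity_def
  proof (rule INF_greatest)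
    fix h assume "h \<in> {g \<in> carrier G. mw_subst G g ?w \<noteq> \<one>}"
    then have "\<not> word_length G S h \<le> enat r"
      using triv conj_comm_word_subst ab by blast
    then show "enat r \<le> word_length G S h" by simp
  qed
  ultimately show ?thesis
    unfolding MIF_growth_def using conj_comm_word_closed[OF ab] conj_comm_word_length[OF S len]
    by (intro SUP_upper2[of ?w]) auto
qed

end

section \<open>A recurrent set of integers with isolated points and gaps\<close>

text \<open>
  Odd stages copy the pattern built so far, which makes it recurrent; even stages add a single point
  far from all others.
\<close>

fun level :: "nat \<Rightarrow> int set" where
  "level 0 = {}"
| "level (Suc j) = level j \<union> (if odd j then (+) (8 ^ Suc j) ` level j else {8 ^ Suc j})"

definition sites :: "int set"
  where "sites = (\<Union>j. level j)"

text \<open>Stage \<open>j\<close> stays in the first quarter of the interval up to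
  \<open>8 ^ Suc j\<close>, where the next stage starts to add points. These quarters produce all
  the gaps below.\<close>

lemma level_bounds: "x \<in> level j \<Longrightarrow> 0 \<le> x \<and> 4 * x \<le> 8 ^ Suc j"
proof (induction j arbitrary: x)
  case (Suc j)
  have pos: "(0::int) < 8 ^ j" by simp
  consider "x \<in> level j" | y where "y \<in> level j" "x = 8 ^ Suc j + y" | "x = 8 ^ Suc j"
    using Suc.prems by (auto split: if_splits)
  then show ?case
  proof cases
    case 1
    then show ?thesis using Suc.IH[of x] pos unfolding power_Suc by linarith
  next
    case 2
    then show ?thesis using Suc.IH[of y] pos unfolding power_Suc by linarith
  next
    case 3
    then show ?thesis using pos unfolding power_Suc by linarith
  qed
qed simp

lemma level_mono: "i \<le> j \<Longrightarrow> level i \<subseteq> level j"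
  by (rule lift_Suc_mono_le) auto

text \<open>Stage \<open>Suc i\<close> adds points only from \<open>8 ^ Suc i\<close> on, so initial
  segments are frozen.\<close>

lemma level_below:
  assumes "x \<in> level i" "x < 8 ^ Suc j"
  shows "x \<in> level j"
proof (cases "i \<le> j")
  case True
  then show ?thesis using level_mono assms by blast
next
  case False
  then have "j \<le> i" by simp
  then show ?thesis
    using assms
  proof (induction i rule: dec_induct)
    case base
    then show ?case by simp
  next
    case (step i)
    have "(8::int) ^ Suc j \<le> 8 ^ Suc i" using step(1) by (intro power_increasing) auto
    then have "x < 8 ^ Suc i" using step.prems(2) by linarith
    moreover have "0 \<le> y" if "y \<in> level i" for y using level_bounds[OF that] ..
    ultimately have "x \<in> level i" using step.prems(1) by (force split: if_splits)
    then show ?case using step.IH step.prems(2) by simp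
  qed
qed

lemma sites_below: "x \<in> sites \<Longrightarrow> x < 8 ^ Suc j \<Longrightarrow> x \<in> level j"
  using level_below by (auto simp: sites_def)

lemma level_sites: "x \<in> level j \<Longrightarrow> x \<in> sites"
  by (auto simp: sites_def)

text \<open>Later stages shift by multiples of \<open>8 ^ Suc k\<close>, so the residue is that of a
  point of \<open>level k\<close>, or zero; \<open>level_bounds\<close> then applies.\<close>

lemma sites_mod:
  assumes "x \<in> sites"
  shows "4 * (x mod 8 ^ Suc k) \<le> 8 ^ Suc k"
proof -
  have "4 * (x mod 8 ^ Suc k) \<le> 8 ^ Suc k" if "x \<in> level j" for j
    using that
  proof (induction j arbitrary: x)
    case (Suc j)
    show ?case
    proof (cases "Suc j \<le> k")
      case True
      then have "x \<in> level k" using Suc.prems level_mono by blast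
      then have "0 \<le> x" "4 * x \<le> 8 ^ Suc k" using level_bounds by auto
      moreover have "(0::int) < 8 ^ k" by simp
      ultimately have "x mod 8 ^ Suc k = x"
        by (intro mod_pos_pos_trivial) (simp, unfold power_Suc, linarith)
      then show ?thesis using \<open>4 * x \<le> 8 ^ Suc k\<close> by simp
    next
      case False
      then have dvd: "(8::int) ^ Suc k dvd 8 ^ Suc j" by (intro le_imp_power_dvd) simp
      consider "x \<in> level j" | y where "y \<in> level j" "x = 8 ^ Suc j + y" | "x = 8 ^ Suc j"
        using Suc.prems by (auto split: if_splits)
      then show ?thesis
      proof cases
        case 1
        then show ?thesis by (rule Suc.IH)
      next
        case 2
        have "x mod 8 ^ Suc k = y mod 8 ^ Suc k"
          using dvd unfolding 2(2) by (metis dvd_eq_mod_eq_0 add_0 mod_add_left_eq)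
        then show ?thesis using Suc.IH[OF 2(1)] by metis
      next
        case 3
        then have "x mod 8 ^ Suc k = 0" using dvd by (metis dvd_eq_mod_eq_0)
        then show ?thesis by simp
      qed
    qed
  qed simp
  then show ?thesis using assms by (auto simp: sites_def)
qed

lemma sites_dvd: "x \<in> sites \<Longrightarrow> 8 dvd x"
proof -
  have "8 dvd x" if "x \<in> level j" for j
    using that by (induction j arbitrary: x) (auto split: if_splits)
  then show "x \<in> sites \<Longrightarrow> 8 dvd x" by (auto simp: sites_def)
qed

text \<open>This makes the transpositions at different sites disjoint.\<close>

lemma sites_Suc: "x \<in> sites \<Longrightarrow> x + 1 \<notin> sites"
  by (drule sites_dvd, rule notI, drule sites_dvd) presburger

text \<open>With \<open>d = 8 ^ Suc k\<close>, a difference of sites is within \<open>d / 4\<close>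
  of a multiple of \<open>d\<close>, whereas \<open>4 * 8 ^ k = d / 2\<close> is at least
  \<open>d / 2\<close> away from each multiple. This leaves
  \<open>d / 4 = 2 * 8 ^ k\<close>.\<close>

lemma sites_gap:
  assumes "p \<in> sites" "q \<in> sites"
  shows "2 * 8 ^ k \<le> \<bar>p - q - 4 * 8 ^ k\<bar>"
proof -
  define d :: int where "d = 8 ^ Suc k"
  have d: "d > 0" "d = 8 * 8 ^ k" by (simp_all add: d_def)
  obtain a b where ab: "p = d * a + p mod d" "q = d * b + q mod d"
    using mult_div_mod_eq[of d] by metis
  have m: "4 * (p mod d) \<le> d" "4 * (q mod d) \<le> d"
    unfolding d_def by (rule sites_mod[OF assms(1)], rule sites_mod[OF assms(2)])
  have n: "0 \<le> p mod d" "0 \<le> q mod d" using d(1) by simp_all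
  have "p - q = d * (a - b) + (p mod d - q mod d)" using ab by (simp add: algebra_simps)
  moreover have "d * (a - b) \<le> 0 \<or> d \<le> d * (a - b)"
  proof (cases "a - b \<le> 0")
    case True
    then show ?thesis using d(1) by (simp add: mult_nonneg_nonpos)
  next
    case False
    then show ?thesis using d(1) by (simp add: mult_le_cancel_left1)
  qed
  ultimately show ?thesis using m n d by linarith
qed

text \<open>A single point added at an even stage works: earlier points lie in a much lower range,
  and later ones begin at the next power of 8.\<close>

lemma sites_isolated: "\<exists>p\<in>sites. \<forall>q\<in>sites. \<bar>q - p\<bar> \<le> int L \<longrightarrow> q = p"
proof -
  \<comment> \<open>An even index, so that the passage to \<open>Suc j\<close> adds one point only;
    it is large enough for \<open>8 ^ j\<close> to exceed \<open>L\<close>.\<close>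
  define j where "j = 2 * L"
  have "L < 8 ^ L" by (rule less_exp[THEN less_le_trans]) (simp add: power_mono)
  also have "(8::nat) ^ L \<le> 8 ^ j" by (intro power_increasing) (auto simp: j_def)
  finally have "int L < int (8 ^ j)" by (simp only: of_nat_less_iff)
  then have L: "int L < 8 ^ j" by simp
  define p :: int where "p = 8 * 8 ^ j"
  have "p \<in> level (Suc j)" by (simp add: p_def j_def)
  moreover have "q = p" if q: "q \<in> sites" "\<bar>q - p\<bar> \<le> int L" for q
  proof -
    have "q < 8 ^ Suc (Suc j)" using q L unfolding p_def power_Suc by linarith
    then have "q \<in> level (Suc j)" using sites_below q by blast
    moreover have "q \<notin> level j"
    proof
      assume "q \<in> level j"
      then have "4 * q \<le> 8 * 8 ^ j" using level_bounds[of q j] by simp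
      then show False using q L unfolding p_def by linarith
    qed
    ultimately show "q = p" by (simp add: p_def j_def)
  qed
  ultimately show ?thesis using level_sites by blast
qed

text \<open>An odd stage copies the whole window around 0. Near \<open>8 ^ Suc j\<close> only this
  copy has points: the original lies below a quarter of that power, and later stages start at the
  next power.\<close>

lemma sites_shift:
  assumes "odd j" "4 * \<bar>y\<bar> \<le> 8 ^ Suc j"
  shows "y + 8 ^ Suc j \<in> sites \<longleftrightarrow> y \<in> sites"
proof -
  define d :: int where "d = 8 ^ Suc j"
  have d: "d > 0" "8 ^ Suc (Suc j) = 8 * d" by (simp_all add: d_def)
  have y: "4 * \<bar>y\<bar> \<le> d" using assms by (simp add: d_def)
  have "d < 4 * (y + d)" using y d(1) by arith
  then have "y + d \<notin> level j" using level_bounds[of "y + d" j] unfolding d_def by force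
  then have "y + d \<in> level (Suc j) \<longleftrightarrow> y \<in> level j"
    using assms(1) by (auto simp: d_def)
  moreover have "y + d \<in> sites \<longleftrightarrow> y + d \<in> level (Suc j)"
  proof -
    have "y + d < 8 ^ Suc (Suc j)" using y d by linarith
    then show ?thesis using sites_below level_sites by blast
  qed
  moreover have "y \<in> sites \<longleftrightarrow> y \<in> level j"
  proof -
    have "y < 8 ^ Suc j" using y d(1) unfolding d_def by linarith
    then show ?thesis using sites_below level_sites by blast
  qed
  ultimately show ?thesis by (simp add: d_def)
qed

section \<open>The group generated by the translation and the swaps at the sites\<close>

definition swap_sites :: "int \<Rightarrow> int"
  where "swap_sites x = (if x \<in> sites then x + 1 else if x - 1 \<in> sites then x - 1 else x)"

lemma swap_sites_involution: "swap_sites (swap_sites x) = x"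
  using sites_Suc[of x] sites_Suc[of "x - 1"] by (auto simp: swap_sites_def)

text \<open>The letter \<open>0\<close> stands for the swap, any other integer for the unit translation of its sign.\<close>

definition letter :: "int \<Rightarrow> int \<Rightarrow> int"
  where "letter n = (if n = 0 then swap_sites else (\<lambda>x. x + sgn n))"

definition act :: "int list \<Rightarrow> int \<Rightarrow> int"
  where "act u = foldr (\<lambda>n f. letter n \<circ> f) u id"

lemma act_simps [simp]: "act [] = id" "act (n # u) = letter n \<circ> act u"
  by (simp_all add: act_def)

lemma act_append: "act (u @ v) = act u \<circ> act v"
  by (induction u) (auto simp: fun_eq_iff)

text \<open>The swap is an involution and \<open>0\<close> is its own negative, so the coding by
  integers turns inversion into negation.\<close>

lemma letter_uminus: "letter (- n) \<circ> letter n = id"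
  by (auto simp: letter_def fun_eq_iff swap_sites_involution)

lemma act_inverse: "act (rev (map uminus u)) \<circ> act u = id"
proof (induction u)
  case (Cons n u)
  have "letter (- n) (letter n y) = y" for y
    using letter_uminus[of n] by (simp add: fun_eq_iff)
  then show ?case using Cons by (simp add: act_append fun_eq_iff)
qed simp

lemma act_displacement: "\<bar>act u x - x\<bar> \<le> int (length u)"
proof (induction u)
  case (Cons n u)
  have "\<bar>letter n y - y\<bar> \<le> 1" for y
    by (auto simp: letter_def swap_sites_def sgn_if)
  from this[of "act u x"] show ?case using Cons by simp
qed simp

text \<open>A word of length \<open>l\<close> inspects the sites only within distance
  \<open>l\<close> of its starting point, so it acts alike wherever the local pattern is the same.
  The swap looks at the current point and at its left neighbour.\<close>

lemma act_shift:
  assumes "\<And>y. \<bar>y - x\<bar> \<le> int (length u) \<Longrightarrow> y + D \<in> sites \<longleftrightarrow> y \<in> sites"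
  shows "act u (x + D) = act u x + D"
  using assms
proof (induction u)
  case (Cons n u)
  have "act u (x + D) = act u x + D" using Cons by simp
  moreover have "act u x + D \<in> sites \<longleftrightarrow> act u x \<in> sites"
    using Cons.prems[of "act u x"] act_displacement[of u x] by simp
  moreover have "act u x - 1 + D \<in> sites \<longleftrightarrow> act u x - 1 \<in> sites"
    using Cons.prems[of "act u x - 1"] act_displacement[of u x] by simp
  ultimately show ?case
    by (auto simp: letter_def swap_sites_def algebra_simps)
qed simp

text \<open>A moved point and the pattern around it recur arbitrarily far out, and each copy is
  moved as well.\<close>

lemma act_infinite_support:
  assumes "act u \<noteq> id"
  shows "infinite {x. act u x \<noteq> x}"
  unfolding infinite_int_iff_unbounded
proof
  fix m :: int
  obtain x where x: "act u x \<noteq> x" using assms by (auto simp: fun_eq_iff)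
  \<comment> \<open>Covers every point inspected from \<open>x\<close>, and makes the translate of
    \<open>x\<close> exceed \<open>m\<close>.\<close>
  define N where "N = \<bar>x\<bar> + int (length u) + \<bar>m\<bar>"
  \<comment> \<open>Odd, because copies are made at odd stages.\<close>
  define j where "j = 2 * nat N + 1"
  have "nat N < 8 ^ nat N" by (rule less_exp[THEN less_le_trans]) (simp add: power_mono)
  also have "(8::nat) ^ nat N \<le> 8 ^ j" by (intro power_increasing) (auto simp: j_def)
  finally have "int (nat N) < int (8 ^ j)" by (simp only: of_nat_less_iff)
  moreover have "0 \<le> N" by (simp add: N_def)
  ultimately have N: "N < 8 ^ j" by simp
  define D :: int where "D = 8 ^ Suc j"
  have D: "4 * N \<le> D" "2 * N < D"
    using N \<open>0 \<le> N\<close> unfolding D_def power_Suc by linarith+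
  have "act u (x + D) = act u x + D"
  proof (rule act_shift)
    fix y assume "\<bar>y - x\<bar> \<le> int (length u)"
    then have "\<bar>y\<bar> \<le> N" unfolding N_def by linarith
    then have "4 * \<bar>y\<bar> \<le> 8 ^ Suc j" using D(1) unfolding D_def by linarith
    then show "y + D \<in> sites \<longleftrightarrow> y \<in> sites"
      unfolding D_def by (intro sites_shift) (simp add: j_def)
  qed
  moreover have "m < \<bar>x + D\<bar>"
    using D(2) unfolding N_def distrib_left by linarith
  ultimately show "\<exists>n. m < \<bar>n\<bar> \<and> n \<in> {x. act u x \<noteq> x}"
    using x by (intro exI[of _ "x + D"]) auto
qed

section \<open>High transitivity on the integers\<close>

lemma act_translation: "\<exists>u. act u = (\<lambda>x. x + n)"
proof -
  have "act (replicate k (sgn n)) = (\<lambda>x. x + int k * sgn n)" if "n \<noteq> 0" for k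
    using that by (induction k) (auto simp: fun_eq_iff letter_def algebra_simps sgn_0_0)
  from this[of "nat \<bar>n\<bar>"] show ?thesis
    by (cases "n = 0") (auto simp: abs_mult_sgn fun_eq_iff intro: exI[of _ "[]"])
qed

text \<open>The closure of the group in the topology of pointwise convergence.\<close>

definition approximable :: "(int \<Rightarrow> int) \<Rightarrow> bool"
  where "approximable f \<longleftrightarrow> (\<forall>B. finite B \<longrightarrow> (\<exists>u. \<forall>x\<in>B. act u x = f x))"

lemma approximable_comp:
  assumes "approximable f" "approximable g"
  shows "approximable (f \<circ> g)"
  unfolding approximable_def
proof (intro allI impI)
  fix B :: "int set" assume "finite B"
  then obtain v where "\<forall>x\<in>B. act v x = g x"
    using assms by (auto simp: approximable_def)
  moreover obtain u where "\<forall>x\<in>g ` B. act u x = f x"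
    using assms \<open>finite B\<close> by (meson approximable_def finite_imageI)
  ultimately show "\<exists>u. \<forall>x\<in>B. act u x = (f \<circ> g) x"
    by (intro exI[of _ "u @ v"]) (simp add: act_append)
qed

text \<open>An isolated site is carried to \<open>i\<close> by a translation.\<close>

lemma approximable_adjacent: "approximable (Transposition.transpose i (i + 1))"
  unfolding approximable_def
proof (intro allI impI)
  fix B :: "int set" assume "finite B"
  then have "finite (insert 0 ((\<lambda>x. \<bar>x - i\<bar>) ` B))" by simp
  then obtain M where "\<forall>y\<in>insert 0 ((\<lambda>x. \<bar>x - i\<bar>) ` B). y \<le> M"
    using bdd_above_finite by (metis bdd_above.unfold)
  then have M: "0 \<le> M" "\<And>x. x \<in> B \<Longrightarrow> \<bar>x - i\<bar> \<le> M" by auto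
  \<comment> \<open>The radius is \<open>M + 1\<close> instead of \<open>M\<close> because the swap
    also tests the left neighbour of a point.\<close>
  obtain p where p: "p \<in> sites" "\<And>q. q \<in> sites \<Longrightarrow> \<bar>q - p\<bar> \<le> M + 1 \<Longrightarrow> q = p"
    using sites_isolated[of "nat (M + 1)"] M by auto
  obtain v w where vw: "act v = (\<lambda>x. x + (i - p))" "act w = (\<lambda>x. x + (p - i))"
    using act_translation by metis
  have "act (v @ [0] @ w) x = Transposition.transpose i (i + 1) x" if "x \<in> B" for x
  proof -
    have 1: "x + (p - i) \<in> sites \<longleftrightarrow> x = i"
      using p(1) p(2)[of "x + (p - i)"] M(2)[OF that] by auto
    have 2: "x + (p - i) - 1 \<in> sites \<longleftrightarrow> x = i + 1"
      using p(1) p(2)[of "x + (p - i) - 1"] M(2)[OF that] by (auto simp: algebra_simps)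
    show ?thesis
      using 1 2 by (auto simp: act_append vw letter_def swap_sites_def Transposition.transpose_def)
  qed
  then show "\<exists>u. \<forall>x\<in>B. act u x = Transposition.transpose i (i + 1) x" by blast
qed

text \<open>Conjugation by an adjacent transposition moves the upper point one step up, so adjacent
  transpositions reach all others.\<close>

lemma approximable_transpose: "approximable (Transposition.transpose a b)"
proof -
  have up: "approximable (Transposition.transpose i (i + 1 + int n))" for i n
  proof (induction n)
    case 0
    then show ?case using approximable_adjacent by simp
  next
    case (Suc n)
    let ?T = "Transposition.transpose (i + 1 + int n) (i + 1 + int n + 1)"
    have "Transposition.transpose i (i + 1 + int (Suc n)) = ?T \<circ> (Transposition.transpose i (i + 1 + int n) \<circ> ?T)"
      by (auto simp: fun_eq_iff Transposition.transpose_def)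
    then show ?case
      using Suc approximable_adjacent approximable_comp by metis
  qed
  consider "a = b" | "a < b" | "b < a" by linarith
  then show ?thesis
  proof cases
    case 1
    then show ?thesis by (auto simp: approximable_def intro: exI[of _ "[]"])
  next
    case 2
    then show ?thesis using up[of a "nat (b - a - 1)"] by simp
  next
    case 3
    then show ?thesis using up[of b "nat (a - b - 1)"] by (simp add: transpose_commute)
  qed
qed

lemma act_inj: "inj (act u)"
  using act_inverse[of u] by (metis inj_on_id inj_on_imageI2)

text \<open>Points are corrected one at a time: the transposition of \<open>act u a\<close> and
  \<open>f a\<close> repairs \<open>a\<close> and fixes the values already right, since
  \<open>f\<close> and \<open>act u\<close> are injective.\<close>

lemma act_extends_injection:
  assumes "finite F" "inj_on f F"
  shows "\<exists>u. \<forall>x\<in>F. act u x = f x"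
  using assms
proof (induction F)
  case (insert a F)
  then obtain u where u: "\<forall>x\<in>F. act u x = f x" by auto
  obtain v where v: "\<forall>y\<in>act u ` insert a F. act v y = Transposition.transpose (act u a) (f a) y"
    using approximable_transpose insert by (meson approximable_def finite.insertI finite_imageI)
  have "act (v @ u) x = f x" if "x \<in> insert a F" for x
  proof (cases "x = a")
    case False
    then have x: "x \<in> F" using that by simp
    then have "f x \<noteq> f a" using False insert.prems by (auto simp: inj_on_def)
    moreover have "act u x \<noteq> act u a" using False by (simp add: inj_eq[OF act_inj])
    ultimately have "Transposition.transpose (act u a) (f a) (act u x) = f x"
      using u x by (simp add: Transposition.transpose_def)
    then show ?thesis using v x by (simp add: act_append)
  qed (use v in \<open>simp add: act_append\<close>)
  then show ?case by blast
qed simp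

section \<open>The permutations as a group on the natural numbers\<close>

definition perms :: "(int \<Rightarrow> int) set"
  where "perms = range act"

lemma countable_perms: "countable perms"
  unfolding perms_def by simp

text \<open>Permutations are replaced by their numbers because the theorem asks for a group on
  \<open>nat\<close>; they are countably many, being given by lists of integers.\<close>

definition site_group :: "nat monoid"
  where "site_group = \<lparr>carrier = to_nat_on perms ` perms,
    monoid.mult = (\<lambda>x y. to_nat_on perms (from_nat_into perms x \<circ> from_nat_into perms y)),
    one = to_nat_on perms id\<rparr>"

abbreviation perm_of :: "nat \<Rightarrow> int \<Rightarrow> int"
  where "perm_of \<equiv> from_nat_into perms"

abbreviation code :: "(int \<Rightarrow> int) \<Rightarrow> nat"
  where "code \<equiv> to_nat_on perms"

lemma perm_of_code [simp]: "f \<in> perms \<Longrightarrow> perm_of (code f) = f"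
  using countable_perms by simp

lemma perms_closed:
  "id \<in> perms" "f \<in> perms \<Longrightarrow> g \<in> perms \<Longrightarrow> f \<circ> g \<in> perms" "act u \<in> perms"
  unfolding perms_def by (auto simp: act_append[symmetric] intro: range_eqI[of _ _ "[]"])

lemma perms_inverse: "f \<in> perms \<Longrightarrow> \<exists>g\<in>perms. g \<circ> f = id"
  unfolding perms_def using act_inverse by blast

lemma perm_of_in: "x \<in> carrier site_group \<Longrightarrow> perm_of x \<in> perms"
  by (auto simp: site_group_def)

lemma code_closed: "f \<in> perms \<Longrightarrow> code f \<in> carrier site_group"
  by (simp add: site_group_def)

lemma perm_of_mult:
  "x \<in> carrier site_group \<Longrightarrow> y \<in> carrier site_group \<Longrightarrow>
    perm_of (x \<otimes>\<^bsub>site_group\<^esub> y) = perm_of x \<circ> perm_of y"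
  by (auto simp: site_group_def perms_closed)

lemma perm_of_one: "perm_of \<one>\<^bsub>site_group\<^esub> = id"
  by (simp add: site_group_def perms_closed)

lemma perm_of_inject:
  "x \<in> carrier site_group \<Longrightarrow> y \<in> carrier site_group \<Longrightarrow> perm_of x = perm_of y \<longleftrightarrow> x = y"
  by (auto simp: site_group_def)

lemma group_site_group: "group site_group"
proof (rule groupI)
  show one: "\<one>\<^bsub>site_group\<^esub> \<in> carrier site_group"
    using perms_closed by (simp add: site_group_def)
  show closed: "x \<otimes>\<^bsub>site_group\<^esub> y \<in> carrier site_group"
    if "x \<in> carrier site_group" "y \<in> carrier site_group" for x y
    using that perms_closed by (auto simp: site_group_def)
  show "x \<otimes>\<^bsub>site_group\<^esub> y \<otimes>\<^bsub>site_group\<^esub> z = x \<otimes>\<^bsub>site_group\<^esub> (y \<otimes>\<^bsub>site_group\<^esub> z)"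
    if "x \<in> carrier site_group" "y \<in> carrier site_group" "z \<in> carrier site_group" for x y z
    using that closed perm_of_mult by (subst perm_of_inject[symmetric]) (auto simp: o_assoc)
  show "\<one>\<^bsub>site_group\<^esub> \<otimes>\<^bsub>site_group\<^esub> x = x" if "x \<in> carrier site_group" for x
    using that closed one perm_of_mult perm_of_one by (subst perm_of_inject[symmetric]) auto
  show "\<exists>y\<in>carrier site_group. y \<otimes>\<^bsub>site_group\<^esub> x = \<one>\<^bsub>site_group\<^esub>"
    if x: "x \<in> carrier site_group" for x
  proof -
    obtain g where g: "g \<in> perms" "g \<circ> perm_of x = id" using perms_inverse perm_of_in x by blast
    then have "code g \<otimes>\<^bsub>site_group\<^esub> x = \<one>\<^bsub>site_group\<^esub>"
      using x code_closed closed one perm_of_mult perm_of_one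
      by (subst perm_of_inject[symmetric]) auto
    then show ?thesis using g code_closed by blast
  qed
qed

lemma translation_perm: "(\<lambda>x. x + n) \<in> perms"
  using act_translation[of n] unfolding perms_def by (metis rangeI)

lemma swap_sites_perm: "swap_sites \<in> perms"
  using perms_closed(3)[of "[0]"] by (simp add: letter_def)

interpretation site: highly_transitive_action site_group perm_of
proof (intro highly_transitive_action.intro highly_transitive_action_axioms.intro)
  show "group site_group" by (rule group_site_group)
  show "perm_of \<one>\<^bsub>site_group\<^esub> = id" by (rule perm_of_one)
  show "perm_of (a \<otimes>\<^bsub>site_group\<^esub> b) = perm_of a \<circ> perm_of b"
    if "a \<in> carrier site_group" "b \<in> carrier site_group" for a b
    using that by (rule perm_of_mult)
  show "infinite {x. perm_of a x \<noteq> x}"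
    if a: "a \<in> carrier site_group" "a \<noteq> \<one>\<^bsub>site_group\<^esub>" for a
  proof -
    have "\<one>\<^bsub>site_group\<^esub> \<in> carrier site_group"
      using group_site_group by (simp add: group.is_monoid)
    then have "perm_of a \<noteq> id" using perm_of_inject a perm_of_one by metis
    moreover obtain u where "perm_of a = act u"
      using perm_of_in[OF a(1)] by (auto simp: perms_def)
    ultimately show ?thesis using act_infinite_support by simp
  qed
  show "\<exists>g\<in>carrier site_group. \<forall>x\<in>F. perm_of g x = f x" if "finite F" "inj_on f F" for F f
    using act_extends_injection[OF that] perms_closed(3) code_closed perm_of_code by metis
  have "perm_of (code (\<lambda>x. x + 1)) \<noteq> perm_of \<one>\<^bsub>site_group\<^esub>"
    using translation_perm[of 1] perm_of_one by (auto simp: fun_eq_iff)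
  then show "\<exists>a\<in>carrier site_group. a \<noteq> \<one>\<^bsub>site_group\<^esub>"
    using translation_perm[of 1] code_closed by metis
qed

lemma site_group_finitely_generated: "finitely_generated site_group"
proof -
  let ?G = site_group
  let ?S = "{code (\<lambda>x. x + 1), code swap_sites}"
  have S: "?S \<subseteq> carrier ?G"
    using translation_perm[of 1] swap_sites_perm code_closed by auto
  have letter: "code (letter n) \<in> generate ?G ?S" for n
  proof -
    consider "n = 0" | "n > 0" | "n < 0" by linarith
    then show ?thesis
    proof cases
      case 3
      have l: "letter n = (\<lambda>x. x + - 1)" using 3 by (auto simp: letter_def)
      let ?t = "code (\<lambda>x. x + 1)"
      have t: "?t \<in> carrier ?G" "code (letter n) \<in> carrier ?G"
        using S translation_perm[of "-1"] code_closed by (auto simp: l)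
      have "code (letter n) \<otimes>\<^bsub>?G\<^esub> ?t = \<one>\<^bsub>?G\<^esub>"
        using t translation_perm[of 1] translation_perm[of "-1"] perm_of_mult perm_of_one
        by (subst perm_of_inject[symmetric]) (auto simp: l fun_eq_iff)
      then have "inv\<^bsub>?G\<^esub> ?t = code (letter n)"
        using site.inv_equality t by blast
      then show ?thesis using generate.inv[of ?t ?S ?G] by simp
    qed (auto simp: letter_def intro: generate.incl)
  qed
  have act: "code (act u) \<in> generate ?G ?S" for u
  proof (induction u)
    case Nil
    have "code (act []) = \<one>\<^bsub>?G\<^esub>" by (simp add: site_group_def)
    then show ?case using generate.one[of ?G ?S] by metis
  next
    case (Cons n u)
    have "code (act (n # u)) = code (letter n) \<otimes>\<^bsub>?G\<^esub> code (act u)"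
      using perms_closed(3)[of "[n]"] perms_closed(3)[of u] by (simp add: site_group_def)
    then show ?case using letter Cons by (metis generate.eng)
  qed
  have "carrier ?G \<subseteq> generate ?G ?S"
  proof
    fix x assume "x \<in> carrier ?G"
    then obtain u where "x = code (act u)" by (auto simp: site_group_def perms_def)
    then show "x \<in> generate ?G ?S" using act by simp
  qed
  then have "finite_generating_set ?G ?S"
    using S site.generate_incl[OF S] by (auto simp: finite_generating_set_def)
  then show ?thesis unfolding finitely_generated_def by blast
qed

section \<open>Growth\<close>

text \<open>An injection sends moved points to moved points, so where \<open>f\<close> moves
  \<open>x\<close>, the map \<open>h\<close> fixes both \<open>x\<close> and \<open>f x\<close>;
  likewise with the roles exchanged.\<close>

lemma commute_disjoint_supports:
  assumes "inj f" "inj h" "\<And>x. f x = x \<or> h x = x"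
  shows "f \<circ> h = h \<circ> f"
proof
  fix x
  show "(f \<circ> h) x = (h \<circ> f) x"
    using assms(3)[of x] assms(3)[of "f x"] assms(3)[of "h x"] injD[OF assms(1)] injD[OF assms(2)]
    by (metis comp_apply)
qed

text \<open>Refuting \<open>sharply_MIF\<close> means refuting it for every finite generating set.
  Each group element has bounded displacement, so any finite set of elements has a common
  bound.\<close>

lemma perm_of_displacement:
  assumes "finite A" "A \<subseteq> carrier site_group"
  shows "\<exists>K::nat. K > 0 \<and> (\<forall>a\<in>A. \<forall>x. \<bar>perm_of a x - x\<bar> \<le> int K)"
proof -
  have "\<forall>a\<in>A. \<exists>k::nat. \<forall>x. \<bar>perm_of a x - x\<bar> \<le> int k"
  proof
    fix a assume "a \<in> A"
    then have "perm_of a \<in> perms" using assms(2) perm_of_in by blast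
    then obtain u where "perm_of a = act u" by (auto simp: perms_def)
    then show "\<exists>k::nat. \<forall>x. \<bar>perm_of a x - x\<bar> \<le> int k"
      using act_displacement[of u] by (intro exI[of _ "length u"]) simp
  qed
  then obtain k where k: "\<And>a x. a \<in> A \<Longrightarrow> \<bar>perm_of a x - x\<bar> \<le> int (k a)" by metis
  have "\<bar>perm_of a x - x\<bar> \<le> int (1 + sum k A)" if "a \<in> A" for a x
  proof -
    have "k a \<le> sum k A" using member_le_sum[of a A k] that assms(1) by simp
    then show ?thesis using k[OF that, of x] by linarith
  qed
  then show ?thesis by (intro exI[of _ "1 + sum k A"]) simp
qed

lemma word_length_displacement:
  assumes S: "S \<subseteq> carrier site_group"
    and K: "\<And>a x. a \<in> S \<union> m_inv site_group ` S \<Longrightarrow> \<bar>perm_of a x - x\<bar> \<le> int K"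
    and g: "word_length site_group S g \<le> enat r"
  shows "\<bar>perm_of g x - x\<bar> \<le> int (K * r)"
proof -
  have SS: "S \<union> m_inv site_group ` S \<subseteq> carrier site_group" using S by auto
  obtain ws where ws: "set ws \<subseteq> S \<union> m_inv site_group ` S" "site.prod_word ws = g"
      "length ws \<le> r"
    using g by (auto simp: site.word_length_le_iff)
  have "\<bar>perm_of (site.prod_word ws) x - x\<bar> \<le> int (K * length ws)"
    using ws(1)
  proof (induction ws)
    case Nil
    then show ?case by (simp add: perm_of_one)
  next
    case (Cons a ws)
    have "set ws \<subseteq> carrier site_group" "a \<in> carrier site_group" using Cons.prems SS by auto
    then have "perm_of (site.prod_word (a # ws)) x = perm_of a (perm_of (site.prod_word ws) x)"
      using perm_of_mult site.prod_word_closed by simp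
    then show ?case
      using Cons K[of a "perm_of (site.prod_word ws) x"] by (simp add: algebra_simps)
  qed
  also have "int (K * length ws) \<le> int (K * r)" using ws(3) by (simp only: of_nat_le_iff mult_le_mono2)
  finally show ?thesis using ws(2) by simp
qed

section \<open>Conjugates of the swap by far translations\<close>

definition shift_elt :: nat
  where "shift_elt = code (\<lambda>x. x + 1)"

definition swap_elt :: nat
  where "swap_elt = code swap_sites"

lemma elts_closed: "shift_elt \<in> carrier site_group" "swap_elt \<in> carrier site_group"
  by (simp_all add: shift_elt_def swap_elt_def code_closed translation_perm swap_sites_perm)

lemma perm_of_swap: "perm_of swap_elt = swap_sites"
  by (simp add: swap_elt_def swap_sites_perm)

lemma perm_of_shift_pow: "perm_of (shift_elt [^]\<^bsub>site_group\<^esub> (m::nat)) x = x + int m"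
proof (induction m arbitrary: x)
  case (Suc m)
  then show ?case
    using perm_of_mult elts_closed translation_perm[of 1] by (simp add: shift_elt_def)
qed (simp add: perm_of_one)

definition far_swap :: "nat \<Rightarrow> nat"
  where "far_swap m = shift_elt [^]\<^bsub>site_group\<^esub> m \<otimes>\<^bsub>site_group\<^esub> swap_elt
    \<otimes>\<^bsub>site_group\<^esub> inv\<^bsub>site_group\<^esub> (shift_elt [^]\<^bsub>site_group\<^esub> m)"

lemma far_swap_closed: "far_swap m \<in> carrier site_group"
  by (simp add: far_swap_def elts_closed)

lemma perm_of_far_swap: "perm_of (far_swap m) x = swap_sites (x - int m) + int m"
proof -
  let ?t = "shift_elt [^]\<^bsub>site_group\<^esub> m"
  have "perm_of ?t (perm_of (inv\<^bsub>site_group\<^esub> ?t) x) = x"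
    using site.act_inv_right elts_closed by simp
  then have "perm_of (inv\<^bsub>site_group\<^esub> ?t) x = x - int m" by (simp add: perm_of_shift_pow)
  then show ?thesis
    by (simp add: far_swap_def perm_of_mult elts_closed perm_of_swap perm_of_shift_pow)
qed

lemma far_swap_word_length:
  assumes "S \<subseteq> carrier site_group"
    and "word_length site_group S shift_elt \<le> enat a" "word_length site_group S swap_elt \<le> enat b"
  shows "word_length site_group S (far_swap m) \<le> enat (m * a + b + m * a)"
  unfolding far_swap_def
  by (intro site.word_length_mult site.word_length_inv site.word_length_pow assms)

lemma perm_of_conj:
  assumes "g \<in> carrier site_group" "b \<in> carrier site_group"
  shows "perm_of (g \<otimes>\<^bsub>site_group\<^esub> b \<otimes>\<^bsub>site_group\<^esub> inv\<^bsub>site_group\<^esub> g) x =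
    perm_of g (perm_of b (perm_of (inv\<^bsub>site_group\<^esub> g) x))"
  using assms by (simp add: perm_of_mult)

text \<open>The supports are disjoint: a common moved point would give two sites whose difference is
  too close to \<open>4 * 8 ^ k\<close>.\<close>

lemma far_swap_commutes:
  assumes g: "g \<in> carrier site_group"
    and small: "\<And>x. \<bar>perm_of g x - x\<bar> + 1 < 2 * 8 ^ k"
  shows "swap_elt \<otimes>\<^bsub>site_group\<^esub> (g \<otimes>\<^bsub>site_group\<^esub> far_swap (4 * 8 ^ k) \<otimes>\<^bsub>site_group\<^esub> inv\<^bsub>site_group\<^esub> g)
    = (g \<otimes>\<^bsub>site_group\<^esub> far_swap (4 * 8 ^ k) \<otimes>\<^bsub>site_group\<^esub> inv\<^bsub>site_group\<^esub> g) \<otimes>\<^bsub>site_group\<^esub> swap_elt"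
    (is "_ \<otimes>\<^bsub>site_group\<^esub> ?h = _")
proof -
  have h: "?h \<in> carrier site_group" using g far_swap_closed by simp
  have "perm_of swap_elt x = x \<or> perm_of ?h x = x" for x
  proof (rule ccontr)
    assume "\<not> ?thesis"
    then have x: "swap_sites x \<noteq> x" "perm_of ?h x \<noteq> x" by (auto simp: perm_of_swap)
    define y where "y = perm_of (inv\<^bsub>site_group\<^esub> g) x"
    have gy: "perm_of g y = x" using site.act_inv_right g by (simp add: y_def)
    then have "perm_of (far_swap (4 * 8 ^ k)) y \<noteq> y"
      using x(2) perm_of_conj[OF g far_swap_closed] by (auto simp: y_def)
    then have "swap_sites (y - 4 * 8 ^ k) \<noteq> y - 4 * 8 ^ k"
      by (auto simp: perm_of_far_swap)
    then obtain q where q: "q \<in> sites" "y - 4 * 8 ^ k - q \<in> {0, 1}"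
      by (auto simp: swap_sites_def split: if_splits)
    obtain p where p: "p \<in> sites" "x - p \<in> {0, 1}"
      using x(1) by (auto simp: swap_sites_def split: if_splits)
    \<comment> \<open>Passing from \<open>x\<close> and \<open>y\<close> to \<open>p\<close> and
      \<open>q\<close> changes the difference by at most 1, which is the summand in
      \<open>small\<close>.\<close>
    have "2 * 8 ^ k \<le> \<bar>p - q - 4 * 8 ^ k\<bar>" using sites_gap p q by blast
    then show False using small[of y] p(2) q(2) unfolding gy by auto
  qed
  then have "perm_of swap_elt \<circ> perm_of ?h = perm_of ?h \<circ> perm_of swap_elt"
    using site.act_inj elts_closed h by (intro commute_disjoint_supports) auto
  then show ?thesis
    using h elts_closed site.m_closed perm_of_mult by (subst perm_of_inject[symmetric]) auto
qed

text \<open>Translating by \<open>1 - m\<close> leaves the swap shifted by 1. At the site 8 the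
  transpositions of 8, 9 and of 9, 10 then overlap.\<close>

lemma far_swap_noncommuting:
  "\<exists>g\<in>carrier site_group.
    swap_elt \<otimes>\<^bsub>site_group\<^esub> (g \<otimes>\<^bsub>site_group\<^esub> far_swap m \<otimes>\<^bsub>site_group\<^esub> inv\<^bsub>site_group\<^esub> g)
    \<noteq> (g \<otimes>\<^bsub>site_group\<^esub> far_swap m \<otimes>\<^bsub>site_group\<^esub> inv\<^bsub>site_group\<^esub> g) \<otimes>\<^bsub>site_group\<^esub> swap_elt"
proof -
  define g where "g = code (\<lambda>x. x + (1 - int m))"
  let ?h = "g \<otimes>\<^bsub>site_group\<^esub> far_swap m \<otimes>\<^bsub>site_group\<^esub> inv\<^bsub>site_group\<^esub> g"
  have g: "g \<in> carrier site_group" "\<And>x. perm_of g x = x + (1 - int m)"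
    using translation_perm code_closed by (auto simp: g_def)
  have "perm_of g (perm_of (inv\<^bsub>site_group\<^esub> g) x) = x" for x
    using g(1) by (rule site.act_inv_right)
  then have inv: "perm_of (inv\<^bsub>site_group\<^esub> g) x = x - (1 - int m)" for x
    using g(2)[of "perm_of (inv\<^bsub>site_group\<^esub> g) x"] by (metis add_diff_cancel_right')
  have h: "perm_of ?h x = swap_sites (x - 1) + 1" for x
    unfolding perm_of_conj[OF g(1) far_swap_closed] inv perm_of_far_swap g(2) by simp
  have hc: "?h \<in> carrier site_group" using g far_swap_closed by simp
  have "8 \<in> level 1" by simp
  then have 8: "8 \<in> sites" by (rule level_sites)
  have "6 \<notin> sites" "7 \<notin> sites" using sites_dvd[of 6] sites_dvd[of 7] by auto
  with 8 have "perm_of (swap_elt \<otimes>\<^bsub>site_group\<^esub> ?h) 8 = 9" "perm_of (?h \<otimes>\<^bsub>site_group\<^esub> swap_elt) 8 = 10"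
    using hc elts_closed
    by (simp_all add: perm_of_mult perm_of_swap h swap_sites_def)
  then have "swap_elt \<otimes>\<^bsub>site_group\<^esub> ?h \<noteq> ?h \<otimes>\<^bsub>site_group\<^esub> swap_elt" by fastforce
  then show ?thesis using g(1) by blast
qed

text \<open>Along the lengths \<open>n k\<close>, linear in \<open>8 ^ k\<close>, the growth is at
  least about \<open>8 ^ k / K\<close>, which no multiple of the logarithm bounds.\<close>

lemma site_group_not_sharply_MIF: "\<not> sharply_MIF site_group"
proof
  assume "sharply_MIF site_group"
  then obtain S C where fg: "finite_generating_set site_group S" and C: "C > 0"
    and bound: "\<And>n. n \<ge> 2 \<Longrightarrow>
      ereal_of_enat (MIF_growth site_group S n) \<le> ereal (C * ln (real n))"
    by (auto simp: sharply_MIF_def)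
  have S: "finite S" "S \<subseteq> carrier site_group" "generate site_group S = carrier site_group"
    using fg by (auto simp: finite_generating_set_def)
  obtain K :: nat where K: "K > 0"
    "\<And>a x. a \<in> S \<union> m_inv site_group ` S \<Longrightarrow> \<bar>perm_of a x - x\<bar> \<le> int K"
  proof -
    have "finite (S \<union> m_inv site_group ` S)" "S \<union> m_inv site_group ` S \<subseteq> carrier site_group"
      using S(1,2) by auto
    from perm_of_displacement[OF this] show thesis using that by blast
  qed
  obtain a b where a: "word_length site_group S shift_elt \<le> enat a"
    and b: "word_length site_group S swap_elt \<le> enat b"
    using site.word_length_finite[OF S(2)] S(3) elts_closed by metis
  \<comment> \<open>The length bound of \<open>MIF_growth_ge\<close> for the swap and its conjugate
    at distance \<open>4 * 8 ^ k\<close>.\<close>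
  define n where "n k = 2 * b + 2 * (4 * 8 ^ k * a + b + 4 * 8 ^ k * a) + 4" for k :: nat
  have "8 ^ k / real K - 1 \<le> C * ln (real (n k))" if "k \<ge> 1" for k
  proof -
    \<comment> \<open>The largest radius for which the displacement bound \<open>K * r\<close> is at
      most \<open>8 ^ k\<close>.\<close>
    define r where "r = 8 ^ k div K"
    have Kr: "K * r \<le> 8 ^ k" by (simp add: r_def)
    \<comment> \<open>Here \<open>k \<ge> 1\<close> matters: for \<open>k = 0\<close> the strict
      bound \<open>8 ^ k + 1 < 2 * 8 ^ k\<close> fails.\<close>
    have "(8::int) ^ 1 \<le> 8 ^ k" using that by (intro power_increasing) auto
    moreover have "int (K * r) \<le> 8 ^ k"
      using Kr by (metis of_nat_le_iff of_nat_numeral of_nat_power)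
    ultimately have r: "int (K * r) + 1 < 2 * 8 ^ k" by simp
    have "enat r \<le> MIF_growth site_group S (n k)"
      unfolding n_def
    proof (rule site.MIF_growth_ge[OF S(2) elts_closed(2) far_swap_closed b
          far_swap_word_length[OF S(2) a b] far_swap_noncommuting])
      fix g assume g: "g \<in> carrier site_group" "word_length site_group S g \<le> enat r"
      have "\<bar>perm_of g x - x\<bar> + 1 < 2 * 8 ^ k" for x
        using word_length_displacement[OF S(2) K(2) g(2), of x] r by linarith
      then show "swap_elt \<otimes>\<^bsub>site_group\<^esub>
          (g \<otimes>\<^bsub>site_group\<^esub> far_swap (4 * 8 ^ k) \<otimes>\<^bsub>site_group\<^esub> inv\<^bsub>site_group\<^esub> g) =
          (g \<otimes>\<^bsub>site_group\<^esub> far_swap (4 * 8 ^ k) \<otimes>\<^bsub>site_group\<^esub> inv\<^bsub>site_group\<^esub> g)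
          \<otimes>\<^bsub>site_group\<^esub> swap_elt"
        by (rule far_swap_commutes[OF g(1)])
    qed
    then have "ereal_of_enat (enat r) \<le> ereal_of_enat (MIF_growth site_group S (n k))"
      by (simp only: ereal_of_enat_le_iff)
    also have "\<dots> \<le> ereal (C * ln (real (n k)))" by (rule bound) (simp add: n_def)
    finally have "real r \<le> C * ln (real (n k))" by simp
    moreover have "8 ^ k / real K - 1 \<le> real r"
    proof -
      have "8 ^ k < K + K * r" unfolding r_def using K(1) by (rule dividend_less_times_div)
      then have "real (8 ^ k) < real (K + K * r)" by (simp only: of_nat_less_iff)
      then show ?thesis using K(1) by (simp add: field_simps)
    qed
    ultimately show ?thesis by linarith
  qed
  then have "eventually (\<lambda>k. 8 ^ k / real K - 1 \<le> C * ln (real (n k))) sequentially"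
    unfolding eventually_sequentially by blast
  \<comment> \<open>Stated for real parameters to compare asymptotics. If \<open>a' = 0\<close>, the
    right-hand side is constant, so this case is separate.\<close>
  moreover have "eventually (\<lambda>k. 8 ^ k / K' - 1 > C * ln (a' * 8 ^ k + b')) sequentially"
    if "K' > 0" "a' \<ge> 0" "b' > 0" for K' a' b' :: real
  proof (cases "a' = 0")
    case True
    show ?thesis unfolding True using that C by real_asymp
  next
    case False
    then have "a' > 0" using that by simp
    then show ?thesis using that C by real_asymp
  qed
  from this[of "real K" "16 * real a" "4 * real b + 4"]
  have "eventually (\<lambda>k. 8 ^ k / real K - 1 > C * ln (real (n k))) sequentially"
    using K(1) by (simp add: n_def algebra_simps)
  ultimately have "eventually (\<lambda>k::nat. False) sequentially"
    by eventually_elim simp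
  then show False by simp
qed

theorem theorem1p10:
  shows "\<exists>G :: nat monoid. group G \<and> finitely_generated G \<and> MIF G \<and> \<not> sharply_MIF G"
  using group_site_group site_group_finitely_generated site.MIF site_group_not_sharply_MIF by blast

end
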